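(* For $P:\mathcal{C}^{op}\to\mathbf{InfSL}$ an elementary doctrine, the elementary quotient completion $\overline{P}:\mathcal{Q}_P^{op}\to\mathbf{InfSL}$ coincides with the doctrine $((P)_q)_x:\mathcal{X}_{(P)_q}^{op}\to\mathbf{InfSL}$.
   Context: $\mathbf{InfSL}$ is the category of inf-semilattices (with top element $\top$) and homomorphisms. An elementary doctrine is a functor $P:\mathcal{C}^{op}\to\mathbf{InfSL}$, $\mathcal{C}$ a category with binary products (the action of $P$ on an arrow $f$ is written $P_f$), such that for every object $A$ of $\mathcal{C}$ there is $\delta_A\in P(A\times A)$ with: (i) $\alpha\mapsto P_{pr_1}(\alpha)\wedge\delta_A$, for $\alpha\in P(A)$, is left adjoint to $P_{\langle id_A,id_A\rangle}:P(A\times A)\to P(A)$; (ii) for every map $e=\langle pr_1,pr_2,pr_2\rangle:X\times A\to X\times A\times A$, the assignment $\alpha\mapsto P_{\langle pr_1,pr_2\rangle}(\alpha)\wedge P_{\langle pr_2,pr_3\rangle}(\delta_A)$, for $\alpha\in P(X\times A)$, is left adjoint to $P_e:P(X\times A\times A)\to P(X\times A)$. A $P$-equivalence relation on $A$ is $\rho\in P(A\times A)$ with $\delta_A\le\rho$; $\rho\le P_{\langle pr_2,pr_1\rangle}(\rho)$; and $P_{\langle pr_1,pr_2\rangle}(\rho)\wedge P_{\langle pr_2,pr_3\rangle}(\rho)\le P_{\langle pr_1,pr_3\rangle}(\rho)$ in $P(A\times A\times A)$. The poset of descent data $\mathcal{D}es_\rho$ is the sub-poset of $P(A)$ of those $\alpha$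 with $P_{pr_1}(\alpha)\wedge\rho\le P_{pr_2}(\alpha)$ in $P(A\times A)$. The category $\mathcal{R}_P$ has as objects pairs $(A,\rho)$ with $\rho$ a $P$-equivalence relation on $A$; an arrow $f:(A,\rho)\to(B,\sigma)$ is an arrow $f:A\to B$ of $\mathcal{C}$ with $\rho\le P_{f\times f}(\sigma)$; composition and identities are those of $\mathcal{C}$. The elementary doctrine $(P)_q:\mathcal{R}_P^{op}\to\mathbf{InfSL}$ is $(P)_q(A,\rho)=\mathcal{D}es_\rho$, acting on an arrow $f$ by restriction of $P_f$. For an elementary doctrine $E:\mathcal{B}^{op}\to\mathbf{InfSL}$, the extensional collapse $\mathcal{X}_E$ is the category whose objects are the objects of $\mathcal{B}$, and whose arrows $[f]:A\to B$ are equivalence classes of arrows $f:A\to B$ of $\mathcal{B}$ such that $\delta_A\le E_{f\times f}(\delta_B)$ in $E(A\times A)$, with respect to the equivalence relating $f$ and $f'$ when $\delta_A\le E_{f\times f'}(\delta_B)$; composition and identities are given on representatives by those of $\mathcal{B}$. The elementary doctrine $(E)_x:\mathcal{X}_E^{op}\to\mathbf{InfSL}$ is $(E)_x(A)=E(A)$ and $((E)_x)_{[f]}=E_f$. The elementary quotient completion $\overline{P}:\mathcal{Q}_P^{op}\to\mathbf{InfSL}$ is defined as follows. Objects of $\mathcal{Q}_P$ are pairs $(A,\rho)$ with $\rho$ a $P$-equivalence relation on $A$; arrows $[f]:(A,\rho)\to(B,\sigma)$ are equivalence classes of arrows $f:A\to B$ of $\mathcal{C}$ such that $\rho\le P_{f\times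 f}(\sigma)$, with respect to the relation $f\sim g$ iff $\rho\le P_{f\times g}(\sigma)$; composition and identities are given on representatives by those of $\mathcal{C}$. On objects $\overline{P}(A,\rho)=\mathcal{D}es_\rho$, and $\overline{P}_{[f]}$ is the restriction of $P_f$. *)

theory Defs
  imports "HOL-Algebra.Galois_Connection"
begin

text \<open>
  Hom-sets are families indexed by pairs of objects and are not required to be disjoint: one and the
  same arrow of \<open>C\<close> may be an arrow between many pairs of objects of a category derived from \<open>C\<close>.
  For this reason composition takes the objects as arguments: for \<open>f\<close> in \<open>Hom C X Y\<close> and \<open>g\<close> in
  \<open>Hom C Y Z\<close>, the composite \<open>g \<circ> f\<close> is \<open>Comp C X Y Z g f\<close>.  All fields are meaningful only on objects
  and on arrows of the appropriate hom-sets.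
\<close>

record ('o, 'a) cat =
  Obj :: "'o set"
  Hom :: "'o \<Rightarrow> 'o \<Rightarrow> 'a set"
  Ident :: "'o \<Rightarrow> 'a"
  Comp :: "'o \<Rightarrow> 'o \<Rightarrow> 'o \<Rightarrow> 'a \<Rightarrow> 'a \<Rightarrow> 'a"

locale category =
  fixes C :: "('o, 'a, 'm) cat_scheme"
  assumes Ident_in_Hom: "X \<in> Obj C \<Longrightarrow> Ident C X \<in> Hom C X X"
    and Comp_in_Hom: "\<lbrakk>X \<in> Obj C; Y \<in> Obj C; Z \<in> Obj C; f \<in> Hom C X Y; g \<in> Hom C Y Z\<rbrakk>
      \<Longrightarrow> Comp C X Y Z g f \<in> Hom C X Z"
    and Comp_Ident_right: "\<lbrakk>X \<in> Obj C; Y \<in> Obj C; f \<in> Hom C X Y\<rbrakk>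
      \<Longrightarrow> Comp C X X Y f (Ident C X) = f"
    and Comp_Ident_left: "\<lbrakk>X \<in> Obj C; Y \<in> Obj C; f \<in> Hom C X Y\<rbrakk>
      \<Longrightarrow> Comp C X Y Y (Ident C Y) f = f"
    and Comp_assoc: "\<lbrakk>W \<in> Obj C; X \<in> Obj C; Y \<in> Obj C; Z \<in> Obj C;
        f \<in> Hom C W X; g \<in> Hom C X Y; h \<in> Hom C Y Z\<rbrakk>
      \<Longrightarrow> Comp C W X Z (Comp C X Y Z h g) f = Comp C W Y Z h (Comp C W X Y g f)"

locale inf_semilattice = lower_semilattice L + weak_partial_order_top L
  for L (structure)

definition inf_hom :: "'p gorder \<Rightarrow> 'p gorder \<Rightarrow> ('p \<Rightarrow> 'p) set" where
  "inf_hom L M = {h \<in> carrier L \<rightarrow> carrier M.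
     h \<top>\<^bsub>L\<^esub> = \<top>\<^bsub>M\<^esub> \<and>
     (\<forall>x \<in> carrier L. \<forall>y \<in> carrier L. h (x \<sqinter>\<^bsub>L\<^esub> y) = h x \<sqinter>\<^bsub>M\<^esub> h y)}"

text \<open>
  A contravariant functor into inf-semilattices: \<open>Fib P X\<close> is \<open>P(X)\<close> and, for \<open>f\<close> in \<open>Hom P X Y\<close>,
  \<open>Reind P X Y f\<close> is the action \<open>P\<^sub>f\<close> from \<open>P(Y)\<close> to \<open>P(X)\<close>.
\<close>

record ('o, 'a, 'p) indexed_poset = "('o, 'a) cat" +
  Fib :: "'o \<Rightarrow> 'p gorder"
  Reind :: "'o \<Rightarrow> 'o \<Rightarrow> 'a \<Rightarrow> 'p \<Rightarrow> 'p"

locale indexed_inf_semilattice = category P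
  for P :: "('o, 'a, 'p, 'm) indexed_poset_scheme" +
  assumes Fib_inf_semilattice: "X \<in> Obj P \<Longrightarrow> inf_semilattice (Fib P X)"
    and Reind_inf_hom: "\<lbrakk>X \<in> Obj P; Y \<in> Obj P; f \<in> Hom P X Y\<rbrakk>
      \<Longrightarrow> Reind P X Y f \<in> inf_hom (Fib P Y) (Fib P X)"
    and Reind_Ident: "\<lbrakk>X \<in> Obj P; \<alpha> \<in> carrier (Fib P X)\<rbrakk>
      \<Longrightarrow> Reind P X X (Ident P X) \<alpha> = \<alpha>"
    and Reind_Comp: "\<lbrakk>X \<in> Obj P; Y \<in> Obj P; Z \<in> Obj P; f \<in> Hom P X Y; g \<in> Hom P Y Z;
        \<alpha> \<in> carrier (Fib P Z)\<rbrakk>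
      \<Longrightarrow> Reind P X Z (Comp P X Y Z g f) \<alpha> = Reind P X Y f (Reind P Y Z g \<alpha>)"

text \<open>Binary products are part of the structure; there need not be a terminal object.\<close>

record ('o, 'a, 'p) prod_indexed_poset = "('o, 'a, 'p) indexed_poset" +
  Prod :: "'o \<Rightarrow> 'o \<Rightarrow> 'o"
  Fst :: "'o \<Rightarrow> 'o \<Rightarrow> 'a"
  Snd :: "'o \<Rightarrow> 'o \<Rightarrow> 'a"

definition is_pairing ::
  "('o, 'a, 'p, 'm) prod_indexed_poset_scheme \<Rightarrow> 'o \<Rightarrow> 'o \<Rightarrow> 'o \<Rightarrow> 'a \<Rightarrow> 'a \<Rightarrow> 'a \<Rightarrow> bool" where
  "is_pairing P X A B f g h \<longleftrightarrow> h \<in> Hom P X (Prod P A B) \<and>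
     Comp P X (Prod P A B) A (Fst P A B) h = f \<and>
     Comp P X (Prod P A B) B (Snd P A B) h = g"

locale prod_indexed_inf_semilattice = indexed_inf_semilattice P
  for P :: "('o, 'a, 'p, 'm) prod_indexed_poset_scheme" +
  assumes Prod_in_Obj: "\<lbrakk>A \<in> Obj P; B \<in> Obj P\<rbrakk> \<Longrightarrow> Prod P A B \<in> Obj P"
    and Fst_in_Hom: "\<lbrakk>A \<in> Obj P; B \<in> Obj P\<rbrakk> \<Longrightarrow> Fst P A B \<in> Hom P (Prod P A B) A"
    and Snd_in_Hom: "\<lbrakk>A \<in> Obj P; B \<in> Obj P\<rbrakk> \<Longrightarrow> Snd P A B \<in> Hom P (Prod P A B) B"
    and ex1_pairing: "\<lbrakk>X \<in> Obj P; A \<in> Obj P; B \<in> Obj P; f \<in> Hom P X A; g \<in> Hom P X B\<rbrakk>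
      \<Longrightarrow> \<exists>!h. is_pairing P X A B f g h"

definition pairing ::
  "('o, 'a, 'p, 'm) prod_indexed_poset_scheme \<Rightarrow> 'o \<Rightarrow> 'o \<Rightarrow> 'o \<Rightarrow> 'a \<Rightarrow> 'a \<Rightarrow> 'a" where
  "pairing P X A B f g = (THE h. is_pairing P X A B f g h)"

text \<open>For \<open>f\<close> from \<open>A\<close> to \<open>C\<close> and \<open>g\<close> from \<open>B\<close> to \<open>D\<close>, this is \<open>f \<times> g\<close> from \<open>A \<times> B\<close> to \<open>C \<times> D\<close>.\<close>

definition prod_arr ::
  "('o, 'a, 'p, 'm) prod_indexed_poset_scheme \<Rightarrow> 'o \<Rightarrow> 'o \<Rightarrow> 'o \<Rightarrow> 'o \<Rightarrow> 'a \<Rightarrow> 'a \<Rightarrow> 'a" where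
  "prod_arr P A B C D f g = pairing P (Prod P A B) C D
     (Comp P (Prod P A B) A C f (Fst P A B))
     (Comp P (Prod P A B) B D g (Snd P A B))"

text \<open>The ternary product \<open>X \<times> A \<times> B\<close> is \<open>(X \<times> A) \<times> B\<close>.\<close>

abbreviation Prod3 ::
  "('o, 'a, 'p, 'm) prod_indexed_poset_scheme \<Rightarrow> 'o \<Rightarrow> 'o \<Rightarrow> 'o \<Rightarrow> 'o" where
  "Prod3 P X A B \<equiv> Prod P (Prod P X A) B"

definition proj1 :: "('o, 'a, 'p, 'm) prod_indexed_poset_scheme \<Rightarrow> 'o \<Rightarrow> 'o \<Rightarrow> 'o \<Rightarrow> 'a" where
  "proj1 P X A B = Comp P (Prod3 P X A B) (Prod P X A) X (Fst P X A) (Fst P (Prod P X A) B)"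

definition proj2 :: "('o, 'a, 'p, 'm) prod_indexed_poset_scheme \<Rightarrow> 'o \<Rightarrow> 'o \<Rightarrow> 'o \<Rightarrow> 'a" where
  "proj2 P X A B = Comp P (Prod3 P X A B) (Prod P X A) A (Snd P X A) (Fst P (Prod P X A) B)"

definition proj3 :: "('o, 'a, 'p, 'm) prod_indexed_poset_scheme \<Rightarrow> 'o \<Rightarrow> 'o \<Rightarrow> 'o \<Rightarrow> 'a" where
  "proj3 P X A B = Snd P (Prod P X A) B"

definition proj12 :: "('o, 'a, 'p, 'm) prod_indexed_poset_scheme \<Rightarrow> 'o \<Rightarrow> 'o \<Rightarrow> 'o \<Rightarrow> 'a" where
  "proj12 P X A B = pairing P (Prod3 P X A B) X A (proj1 P X A B) (proj2 P X A B)"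

definition proj23 :: "('o, 'a, 'p, 'm) prod_indexed_poset_scheme \<Rightarrow> 'o \<Rightarrow> 'o \<Rightarrow> 'o \<Rightarrow> 'a" where
  "proj23 P X A B = pairing P (Prod3 P X A B) A B (proj2 P X A B) (proj3 P X A B)"

definition proj13 :: "('o, 'a, 'p, 'm) prod_indexed_poset_scheme \<Rightarrow> 'o \<Rightarrow> 'o \<Rightarrow> 'o \<Rightarrow> 'a" where
  "proj13 P X A B = pairing P (Prod3 P X A B) X B (proj1 P X A B) (proj3 P X A B)"

definition diag :: "('o, 'a, 'p, 'm) prod_indexed_poset_scheme \<Rightarrow> 'o \<Rightarrow> 'a" where
  "diag P A = pairing P A A A (Ident P A) (Ident P A)"

definition swap :: "('o, 'a, 'p, 'm) prod_indexed_poset_scheme \<Rightarrow> 'o \<Rightarrow> 'a" where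
  "swap P A = pairing P (Prod P A A) A A (Snd P A A) (Fst P A A)"

text \<open>\<open>\<langle>pr\<^sub>1, pr\<^sub>2, pr\<^sub>2\<rangle>\<close> from \<open>X \<times> A\<close> to \<open>X \<times> A \<times> A\<close>\<close>

definition pdiag :: "('o, 'a, 'p, 'm) prod_indexed_poset_scheme \<Rightarrow> 'o \<Rightarrow> 'o \<Rightarrow> 'a" where
  "pdiag P X A = pairing P (Prod P X A) (Prod P X A) A
     (pairing P (Prod P X A) X A (Fst P X A) (Snd P X A)) (Snd P X A)"

definition is_fibred_equality ::
  "('o, 'a, 'p, 'm) prod_indexed_poset_scheme \<Rightarrow> 'o \<Rightarrow> 'p \<Rightarrow> bool" where
  "is_fibred_equality P A \<delta> \<longleftrightarrow> \<delta> \<in> carrier (Fib P (Prod P A A)) \<and>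
     galois_connection
       \<lparr>orderA = Fib P A, orderB = Fib P (Prod P A A),
        lower = (\<lambda>\<alpha>. Reind P (Prod P A A) A (Fst P A A) \<alpha> \<sqinter>\<^bsub>Fib P (Prod P A A)\<^esub> \<delta>),
        upper = Reind P A (Prod P A A) (diag P A)\<rparr> \<and>
     (\<forall>X \<in> Obj P. galois_connection
       \<lparr>orderA = Fib P (Prod P X A), orderB = Fib P (Prod3 P X A A),
        lower = (\<lambda>\<alpha>. Reind P (Prod3 P X A A) (Prod P X A) (proj12 P X A A) \<alpha>
          \<sqinter>\<^bsub>Fib P (Prod3 P X A A)\<^esub> Reind P (Prod3 P X A A) (Prod P A A) (proj23 P X A A) \<delta>),
        upper = Reind P (Prod P X A) (Prod3 P X A A) (pdiag P X A)\<rparr>)"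

locale elementary_doctrine = prod_indexed_inf_semilattice P
  for P :: "('o, 'a, 'p, 'm) prod_indexed_poset_scheme" +
  assumes ex_fibred_equality: "A \<in> Obj P \<Longrightarrow> \<exists>\<delta>. is_fibred_equality P A \<delta>"

text \<open>Left adjoints being unique, there is exactly one \<open>\<delta>\<^sub>A\<close>: the value of the left adjoint at \<open>\<top>\<close>.\<close>

definition fib_eq :: "('o, 'a, 'p, 'm) prod_indexed_poset_scheme \<Rightarrow> 'o \<Rightarrow> 'p" where
  "fib_eq P A = (THE \<delta>. is_fibred_equality P A \<delta>)"

definition is_equiv_rel ::
  "('o, 'a, 'p, 'm) prod_indexed_poset_scheme \<Rightarrow> 'o \<Rightarrow> 'p \<Rightarrow> bool" where
  "is_equiv_rel P A \<rho> \<longleftrightarrow> \<rho> \<in> carrier (Fib P (Prod P A A)) \<and>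
     fib_eq P A \<sqsubseteq>\<^bsub>Fib P (Prod P A A)\<^esub> \<rho> \<and>
     \<rho> \<sqsubseteq>\<^bsub>Fib P (Prod P A A)\<^esub> Reind P (Prod P A A) (Prod P A A) (swap P A) \<rho> \<and>
     Reind P (Prod3 P A A A) (Prod P A A) (proj12 P A A A) \<rho>
       \<sqinter>\<^bsub>Fib P (Prod3 P A A A)\<^esub> Reind P (Prod3 P A A A) (Prod P A A) (proj23 P A A A) \<rho>
       \<sqsubseteq>\<^bsub>Fib P (Prod3 P A A A)\<^esub> Reind P (Prod3 P A A A) (Prod P A A) (proj13 P A A A) \<rho>"

definition Des :: "('o, 'a, 'p, 'm) prod_indexed_poset_scheme \<Rightarrow> 'o \<Rightarrow> 'p \<Rightarrow> 'p gorder" where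
  "Des P A \<rho> = (Fib P A)\<lparr>carrier := {\<alpha> \<in> carrier (Fib P A).
     Reind P (Prod P A A) A (Fst P A A) \<alpha> \<sqinter>\<^bsub>Fib P (Prod P A A)\<^esub> \<rho>
       \<sqsubseteq>\<^bsub>Fib P (Prod P A A)\<^esub> Reind P (Prod P A A) A (Snd P A A) \<alpha>}\<rparr>"

text \<open>
  The product of \<open>(A, \<rho>)\<close> and \<open>(B, \<sigma>)\<close> is \<open>A \<times> B\<close> with the relation
  \<open>P\<^bsub>\<langle>pr\<^sub>1, pr\<^sub>3\<rangle>\<^esub>(\<rho>) \<and> P\<^bsub>\<langle>pr\<^sub>2, pr\<^sub>4\<rangle>\<^esub>(\<sigma>)\<close> on \<open>(A \<times> B) \<times> (A \<times> B)\<close>, and the projections are those of \<open>A \<times> B\<close>.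
\<close>

definition prod_rel ::
  "('o, 'a, 'p, 'm) prod_indexed_poset_scheme \<Rightarrow> 'o \<Rightarrow> 'o \<Rightarrow> 'p \<Rightarrow> 'p \<Rightarrow> 'p" where
  "prod_rel P A B \<rho> \<sigma> =
     Reind P (Prod P (Prod P A B) (Prod P A B)) (Prod P A A)
       (prod_arr P (Prod P A B) (Prod P A B) A A (Fst P A B) (Fst P A B)) \<rho>
     \<sqinter>\<^bsub>Fib P (Prod P (Prod P A B) (Prod P A B))\<^esub>
     Reind P (Prod P (Prod P A B) (Prod P A B)) (Prod P B B)
       (prod_arr P (Prod P A B) (Prod P A B) B B (Snd P A B) (Snd P A B)) \<sigma>"

definition equiv_doctrine ::
  "('o, 'a, 'p, 'm) prod_indexed_poset_scheme \<Rightarrow> ('o \<times> 'p, 'a, 'p) prod_indexed_poset" where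
  "equiv_doctrine P = \<lparr>
     Obj = {(A, \<rho>). A \<in> Obj P \<and> is_equiv_rel P A \<rho>},
     Hom = (\<lambda>(A, \<rho>) (B, \<sigma>). {f \<in> Hom P A B.
       \<rho> \<sqsubseteq>\<^bsub>Fib P (Prod P A A)\<^esub> Reind P (Prod P A A) (Prod P B B) (prod_arr P A A B B f f) \<sigma>}),
     Ident = (\<lambda>(A, \<rho>). Ident P A),
     Comp = (\<lambda>(A, \<rho>) (B, \<sigma>) (C, \<tau>). Comp P A B C),
     Fib = (\<lambda>(A, \<rho>). Des P A \<rho>),
     Reind = (\<lambda>(A, \<rho>) (B, \<sigma>). Reind P A B),
     Prod = (\<lambda>(A, \<rho>) (B, \<sigma>). (Prod P A B, prod_rel P A B \<rho> \<sigma>)),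
     Fst = (\<lambda>(A, \<rho>) (B, \<sigma>). Fst P A B),
     Snd = (\<lambda>(A, \<rho>) (B, \<sigma>). Snd P A B)\<rparr>"

definition ext_arrows ::
  "('o, 'a, 'p, 'm) prod_indexed_poset_scheme \<Rightarrow> 'o \<Rightarrow> 'o \<Rightarrow> 'a set" where
  "ext_arrows E A B = {f \<in> Hom E A B.
     fib_eq E A \<sqsubseteq>\<^bsub>Fib E (Prod E A A)\<^esub>
       Reind E (Prod E A A) (Prod E B B) (prod_arr E A A B B f f) (fib_eq E B)}"

definition ext_rel ::
  "('o, 'a, 'p, 'm) prod_indexed_poset_scheme \<Rightarrow> 'o \<Rightarrow> 'o \<Rightarrow> ('a \<times> 'a) set" where
  "ext_rel E A B = {(f, f'). f \<in> ext_arrows E A B \<and> f' \<in> ext_arrows E A B \<and>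
     fib_eq E A \<sqsubseteq>\<^bsub>Fib E (Prod E A A)\<^esub>
       Reind E (Prod E A A) (Prod E B B) (prod_arr E A A B B f f') (fib_eq E B)}"

text \<open>
  Operations on equivalence classes are computed on representatives, selected by \<open>SOME\<close>.
\<close>

definition ext_collapse ::
  "('o, 'a, 'p, 'm) prod_indexed_poset_scheme \<Rightarrow> ('o, 'a set, 'p) indexed_poset" where
  "ext_collapse E = \<lparr>
     Obj = Obj E,
     Hom = (\<lambda>A B. ext_arrows E A B // ext_rel E A B),
     Ident = (\<lambda>A. ext_rel E A A `` {Ident E A}),
     Comp = (\<lambda>A B C G F. ext_rel E A C `` {Comp E A B C (SOME g. g \<in> G) (SOME f. f \<in> F)}),
     Fib = Fib E,
     Reind = (\<lambda>A B F. Reind E A B (SOME f. f \<in> F))\<rparr>"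

definition quot_arrows ::
  "('o, 'a, 'p, 'm) prod_indexed_poset_scheme \<Rightarrow> 'o \<times> 'p \<Rightarrow> 'o \<times> 'p \<Rightarrow> 'a set" where
  "quot_arrows P = (\<lambda>(A, \<rho>) (B, \<sigma>). {f \<in> Hom P A B.
     \<rho> \<sqsubseteq>\<^bsub>Fib P (Prod P A A)\<^esub> Reind P (Prod P A A) (Prod P B B) (prod_arr P A A B B f f) \<sigma>})"

definition quot_rel ::
  "('o, 'a, 'p, 'm) prod_indexed_poset_scheme \<Rightarrow> 'o \<times> 'p \<Rightarrow> 'o \<times> 'p \<Rightarrow> ('a \<times> 'a) set" where
  "quot_rel P = (\<lambda>(A, \<rho>) (B, \<sigma>). {(f, g).
     f \<in> quot_arrows P (A, \<rho>) (B, \<sigma>) \<and> g \<in> quot_arrows P (A, \<rho>) (B, \<sigma>) \<and>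
     \<rho> \<sqsubseteq>\<^bsub>Fib P (Prod P A A)\<^esub> Reind P (Prod P A A) (Prod P B B) (prod_arr P A A B B f g) \<sigma>})"

definition quot_completion ::
  "('o, 'a, 'p, 'm) prod_indexed_poset_scheme \<Rightarrow> ('o \<times> 'p, 'a set, 'p) indexed_poset" where
  "quot_completion P = \<lparr>
     Obj = {(A, \<rho>). A \<in> Obj P \<and> is_equiv_rel P A \<rho>},
     Hom = (\<lambda>X Y. quot_arrows P X Y // quot_rel P X Y),
     Ident = (\<lambda>X. quot_rel P X X `` {Ident P (fst X)}),
     Comp = (\<lambda>X Y Z G F. quot_rel P X Z ``
       {Comp P (fst X) (fst Y) (fst Z) (SOME g. g \<in> G) (SOME f. f \<in> F)}),
     Fib = (\<lambda>(A, \<rho>). Des P A \<rho>),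
     Reind = (\<lambda>X Y F. Reind P (fst X) (fst Y) (SOME f. f \<in> F))\<rparr>"

text \<open>
  Equality of all data, disregarding the irrelevant values of the record fields outside objects,
  hom-sets and carriers.
\<close>

definition coincide ::
  "('o, 'a, 'p) indexed_poset \<Rightarrow> ('o, 'a, 'p) indexed_poset \<Rightarrow> bool" where
  "coincide D E \<longleftrightarrow>
     Obj D = Obj E \<and>
     (\<forall>X \<in> Obj D. \<forall>Y \<in> Obj D. Hom D X Y = Hom E X Y) \<and>
     (\<forall>X \<in> Obj D. Ident D X = Ident E X) \<and>
     (\<forall>X \<in> Obj D. \<forall>Y \<in> Obj D. \<forall>Z \<in> Obj D. \<forall>f \<in> Hom D X Y. \<forall>g \<in> Hom D Y Z.
        Comp D X Y Z g f = Comp E X Y Z g f) \<and>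
     (\<forall>X \<in> Obj D. Fib D X = Fib E X) \<and>
     (\<forall>X \<in> Obj D. \<forall>Y \<in> Obj D. \<forall>f \<in> Hom D X Y. \<forall>\<alpha> \<in> carrier (Fib D Y).
        Reind D X Y f \<alpha> = Reind E X Y f \<alpha>)"

end

theory Submission
  imports Defs
begin

text \<open>
  Everything in \<open>\<X>\<close> over the doctrine of descent data is defined from the fibred equality of that
  doctrine, and everything in \<open>\<Q>\<^sub>P\<close> from the given equivalence relations.  The two agree because the
  fibred equality of the object \<open>(A, \<rho>)\<close> is \<open>\<rho>\<close> itself (\<open>fib_eq_equiv_doctrine\<close>): once \<open>\<delta>\<close> is replaced
  by \<open>\<rho>\<close>, the arrows and the relation between them are given by the same formulas, and what is left
  is inherited from \<open>P\<close> on both sides.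

  That \<open>\<rho>\<close> is the fibred equality means that \<open>\<alpha> \<mapsto> P\<^bsub>pr\<^sub>1\<^esub>(\<alpha>) \<and> \<rho>\<close> is left adjoint to reindexing along
  the diagonal, as a map between posets of descent data, and likewise with a parameter.
  One half of the adjunction is reflexivity of \<open>\<rho>\<close>.  The other half is descent: if \<open>\<beta>(x, y)\<close> is a
  descent datum on \<open>(A, \<rho>) \<times> (A, \<rho>)\<close>, then \<open>\<rho>(x, y)\<close> relates \<open>(x, x)\<close> to \<open>(x, y)\<close> in the product
  relation, so that \<open>\<beta>(x, x) \<and> \<rho>(x, y) \<le> \<beta>(x, y)\<close>.  Finally \<open>\<rho>\<close> is a descent datum on
  \<open>(A, \<rho>) \<times> (A, \<rho>)\<close> by symmetry and transitivity.

  Arguments such as these are carried out with generalized elements: for \<open>x, y\<close> from \<open>T\<close> to \<open>A\<close>, put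
  \<open>\<rho>(x, y) = P\<^bsub>\<langle>x, y\<rangle>\<^esub>(\<rho>)\<close>.  An inequality in a fibre over a product holds as soon as it holds at all
  generalized elements, the projections being the generic ones, and in this form the
  conditions on equivalence relations, descent data and arrows read as in ordinary set theory.

  The uniqueness of \<open>\<delta>\<close>, without which \<open>\<rho>\<close> could not be identified with the chosen one, is available
  in any indexed inf-semilattice with binary products; for descent data such a structure is obtained
  in \<open>prod_indexed_inf_semilattice_equiv_doctrine\<close>.
\<close>

section \<open>Inf-semilattices\<close>

context inf_semilattice
begin

lemma top_meet_eq: "x \<in> carrier L \<Longrightarrow> \<top> \<sqinter> x = x"
  by (meson le_antisym le_refl meet_closed meet_le meet_right top_closed top_higher)

lemma meet_top_eq: "x \<in> carrier L \<Longrightarrow> x \<sqinter> \<top> = x"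
  using top_meet_eq meet_comm by metis

lemma top_le_iff: "x \<in> carrier L \<Longrightarrow> \<top> \<sqsubseteq> x \<longleftrightarrow> x = \<top>"
  by (metis le_antisym le_refl top_closed top_higher)

lemma le_iff_meet_eq: "\<lbrakk>x \<in> carrier L; y \<in> carrier L\<rbrakk> \<Longrightarrow> x \<sqsubseteq> y \<longleftrightarrow> x \<sqinter> y = x"
  by (metis le_antisym le_refl meet_closed meet_le meet_left meet_right)

lemma le_meet_iff:
  "\<lbrakk>x \<in> carrier L; y \<in> carrier L; z \<in> carrier L\<rbrakk> \<Longrightarrow> z \<sqsubseteq> x \<sqinter> y \<longleftrightarrow> z \<sqsubseteq> x \<and> z \<sqsubseteq> y"
  by (meson le_trans meet_closed meet_le meet_left meet_right)

lemma meet_le_left: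
  "\<lbrakk>x \<sqsubseteq> z; x \<in> carrier L; y \<in> carrier L; z \<in> carrier L\<rbrakk> \<Longrightarrow> x \<sqinter> y \<sqsubseteq> z"
  by (meson le_trans meet_closed meet_left)

lemma meet_le_right:
  "\<lbrakk>y \<sqsubseteq> z; x \<in> carrier L; y \<in> carrier L; z \<in> carrier L\<rbrakk> \<Longrightarrow> x \<sqinter> y \<sqsubseteq> z"
  by (meson le_trans meet_closed meet_right)

lemma meet_mono:
  "\<lbrakk>x \<sqsubseteq> x'; y \<sqsubseteq> y'; x \<in> carrier L; y \<in> carrier L; x' \<in> carrier L; y' \<in> carrier L\<rbrakk>
    \<Longrightarrow> x \<sqinter> y \<sqsubseteq> x' \<sqinter> y'"
  by (simp add: le_meet_iff meet_le_left meet_le_right)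

lemma meet_interchange_le:
  assumes le: "a \<sqinter> a' \<sqsubseteq> c" "b \<sqinter> b' \<sqsubseteq> d"
    and cl: "a \<in> carrier L" "b \<in> carrier L" "a' \<in> carrier L" "b' \<in> carrier L"
      "c \<in> carrier L" "d \<in> carrier L"
  shows "(a \<sqinter> b) \<sqinter> (a' \<sqinter> b') \<sqsubseteq> c \<sqinter> d"
proof (rule meet_le)
  have "(a \<sqinter> b) \<sqinter> (a' \<sqinter> b') \<sqsubseteq> a \<sqinter> a'" "(a \<sqinter> b) \<sqinter> (a' \<sqinter> b') \<sqsubseteq> b \<sqinter> b'"
    using cl by (simp_all add: meet_mono meet_left meet_right)
  then show "(a \<sqinter> b) \<sqinter> (a' \<sqinter> b') \<sqsubseteq> c" "(a \<sqinter> b) \<sqinter> (a' \<sqinter> b') \<sqsubseteq> d"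
    using le cl le_trans[OF _ le(1)] le_trans[OF _ le(2)] by simp_all
qed (use cl in simp_all)

lemma meet_idem: "x \<in> carrier L \<Longrightarrow> x \<sqinter> x = x"
  using le_iff_meet_eq by blast

lemma top_unique: "\<lbrakk>t \<in> carrier L; \<And>x. x \<in> carrier L \<Longrightarrow> x \<sqsubseteq> t\<rbrakk> \<Longrightarrow> \<top> = t"
  by (metis top_closed top_le_iff)

lemma meet_unique:
  "\<lbrakk>x \<in> carrier L; y \<in> carrier L; m \<in> carrier L; m \<sqsubseteq> x; m \<sqsubseteq> y;
    \<And>z. \<lbrakk>z \<in> carrier L; z \<sqsubseteq> x; z \<sqsubseteq> y\<rbrakk> \<Longrightarrow> z \<sqsubseteq> m\<rbrakk> \<Longrightarrow> x \<sqinter> y = m"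
  by (meson le_antisym meet_closed meet_le meet_left meet_right)

end

text \<open>
  Top and meet are chosen by \<open>SOME\<close>, separately for each carrier.  Antisymmetry makes the choices in
  the larger and in the smaller carrier coincide.
\<close>

lemma (in inf_semilattice)
  assumes sub: "S \<subseteq> carrier L" and top: "\<top> \<in> S"
    and meet: "\<And>x y. \<lbrakk>x \<in> S; y \<in> S\<rbrakk> \<Longrightarrow> x \<sqinter> y \<in> S"
  shows inf_semilattice_subset: "inf_semilattice (L\<lparr>carrier := S\<rparr>)"
    and top_subset: "\<top>\<^bsub>L\<lparr>carrier := S\<rparr>\<^esub> = \<top>"
    and meet_subset: "\<lbrakk>x \<in> S; y \<in> S\<rbrakk> \<Longrightarrow> x \<sqinter>\<^bsub>L\<lparr>carrier := S\<rparr>\<^esub> y = x \<sqinter> y"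
proof -
  let ?S = "L\<lparr>carrier := S\<rparr>"
  have po: "weak_partial_order ?S"
    by (rule weak_partial_order_subset[OF weak_partial_order_axioms sub])
  have glb: "greatest ?S (x \<sqinter> y) (Lower ?S {x, y})" if "x \<in> S" "y \<in> S" for x y
    using that sub by (auto simp: greatest_def Lower_def meet subset_iff meet_left meet_right intro: meet_le)
  have gr: "greatest ?S \<top> (carrier ?S)"
    using sub top by (auto simp: greatest_def subset_iff)
  show S: "inf_semilattice ?S"
    unfolding inf_semilattice_def lower_semilattice_def lower_semilattice_axioms_def
      partial_order_def partial_order_axioms_def weak_partial_order_top_def
      weak_partial_order_top_axioms_def
    using po glb gr eq_is_equal by auto
  interpret S: inf_semilattice ?S by (fact S)
  show "\<top>\<^bsub>?S\<^esub> = \<top>"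
    using sub top by (intro S.top_unique) auto
  show "x \<sqinter>\<^bsub>?S\<^esub> y = x \<sqinter> y" if "x \<in> S" "y \<in> S"
    using that sub meet by (intro S.meet_unique) (auto simp: subset_iff meet_left meet_right intro: meet_le)
qed

section \<open>Indexed inf-semilattices with binary products\<close>

context indexed_inf_semilattice
begin

lemma Reind_closed [simp]:
  "\<lbrakk>X \<in> Obj P; Y \<in> Obj P; f \<in> Hom P X Y; \<alpha> \<in> carrier (Fib P Y)\<rbrakk>
    \<Longrightarrow> Reind P X Y f \<alpha> \<in> carrier (Fib P X)"
  using Reind_inf_hom[of X Y f] by (auto simp: inf_hom_def)

lemma Reind_top [simp]:
  "\<lbrakk>X \<in> Obj P; Y \<in> Obj P; f \<in> Hom P X Y\<rbrakk> \<Longrightarrow> Reind P X Y f \<top>\<^bsub>Fib P Y\<^esub> = \<top>\<^bsub>Fib P X\<^esub>"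
  using Reind_inf_hom[of X Y f] by (auto simp: inf_hom_def)

lemma Reind_meet [simp]:
  "\<lbrakk>X \<in> Obj P; Y \<in> Obj P; f \<in> Hom P X Y; \<alpha> \<in> carrier (Fib P Y); \<beta> \<in> carrier (Fib P Y)\<rbrakk>
    \<Longrightarrow> Reind P X Y f (\<alpha> \<sqinter>\<^bsub>Fib P Y\<^esub> \<beta>) = Reind P X Y f \<alpha> \<sqinter>\<^bsub>Fib P X\<^esub> Reind P X Y f \<beta>"
  using Reind_inf_hom[of X Y f] by (auto simp: inf_hom_def)

lemma Fib_le_refl [simp]: "\<lbrakk>X \<in> Obj P; \<alpha> \<in> carrier (Fib P X)\<rbrakk> \<Longrightarrow> \<alpha> \<sqsubseteq>\<^bsub>Fib P X\<^esub> \<alpha>"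
  using Fib_inf_semilattice[of X]
  by (simp add: inf_semilattice_def lower_semilattice_def partial_order_def weak_partial_order.le_refl)

lemma Reind_mono:
  assumes "X \<in> Obj P" "Y \<in> Obj P" "f \<in> Hom P X Y" "\<alpha> \<in> carrier (Fib P Y)" "\<beta> \<in> carrier (Fib P Y)"
    and "\<alpha> \<sqsubseteq>\<^bsub>Fib P Y\<^esub> \<beta>"
  shows "Reind P X Y f \<alpha> \<sqsubseteq>\<^bsub>Fib P X\<^esub> Reind P X Y f \<beta>"
  using assms Reind_meet[of X Y f \<alpha> \<beta>] Reind_closed[of X Y f]
  by (metis Fib_inf_semilattice inf_semilattice.le_iff_meet_eq)

lemmas [simp] = Ident_in_Hom Comp_in_Hom Comp_Ident_right Comp_Ident_left Comp_assoc Reind_Ident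

text \<open>
  Iterated reindexing is normalized to reindexing along one composite, so that equations between
  reindexings reduce to equations between arrows.
\<close>

lemmas [simp] = Reind_Comp[symmetric]

end

context prod_indexed_inf_semilattice
begin

lemmas [simp] = Prod_in_Obj Fst_in_Hom Snd_in_Hom

lemma is_pairing_pairing:
  "\<lbrakk>X \<in> Obj P; A \<in> Obj P; B \<in> Obj P; f \<in> Hom P X A; g \<in> Hom P X B\<rbrakk>
    \<Longrightarrow> is_pairing P X A B f g (pairing P X A B f g)"
  unfolding pairing_def by (rule theI'[OF ex1_pairing])

lemma pairing_eqI:
  "\<lbrakk>X \<in> Obj P; A \<in> Obj P; B \<in> Obj P; f \<in> Hom P X A; g \<in> Hom P X B; is_pairing P X A B f g h\<rbrakk>
    \<Longrightarrow> pairing P X A B f g = h"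
  using ex1_pairing is_pairing_pairing by blast

lemma pairing_in_Hom [simp]:
  "\<lbrakk>X \<in> Obj P; A \<in> Obj P; B \<in> Obj P; f \<in> Hom P X A; g \<in> Hom P X B\<rbrakk>
    \<Longrightarrow> pairing P X A B f g \<in> Hom P X (Prod P A B)"
  using is_pairing_pairing by (simp add: is_pairing_def)

lemma Fst_pairing [simp]:
  "\<lbrakk>X \<in> Obj P; A \<in> Obj P; B \<in> Obj P; f \<in> Hom P X A; g \<in> Hom P X B\<rbrakk>
    \<Longrightarrow> Comp P X (Prod P A B) A (Fst P A B) (pairing P X A B f g) = f"
  using is_pairing_pairing by (simp add: is_pairing_def)

lemma Snd_pairing [simp]:
  "\<lbrakk>X \<in> Obj P; A \<in> Obj P; B \<in> Obj P; f \<in> Hom P X A; g \<in> Hom P X B\<rbrakk>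
    \<Longrightarrow> Comp P X (Prod P A B) B (Snd P A B) (pairing P X A B f g) = g"
  using is_pairing_pairing by (simp add: is_pairing_def)

lemma pairing_Fst_Snd_Comp [simp]:
  "\<lbrakk>X \<in> Obj P; A \<in> Obj P; B \<in> Obj P; h \<in> Hom P X (Prod P A B)\<rbrakk>
    \<Longrightarrow> pairing P X A B (Comp P X (Prod P A B) A (Fst P A B) h)
          (Comp P X (Prod P A B) B (Snd P A B) h) = h"
  by (rule pairing_eqI) (simp_all add: is_pairing_def)

lemma pairing_Fst_Snd [simp]:
  "\<lbrakk>A \<in> Obj P; B \<in> Obj P\<rbrakk>
    \<Longrightarrow> pairing P (Prod P A B) A B (Fst P A B) (Snd P A B) = Ident P (Prod P A B)"
  by (rule pairing_eqI) (simp_all add: is_pairing_def)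

lemma pairing_Comp [simp]:
  assumes "T \<in> Obj P" "X \<in> Obj P" "A \<in> Obj P" "B \<in> Obj P"
    and "f \<in> Hom P X A" "g \<in> Hom P X B" "h \<in> Hom P T X"
  shows "Comp P T X (Prod P A B) (pairing P X A B f g) h
    = pairing P T A B (Comp P T X A f h) (Comp P T X B g h)"
  by (rule sym, rule pairing_eqI)
    (use assms in \<open>simp_all add: is_pairing_def flip: Comp_assoc\<close>)

lemma Prod_arrow_cases:
  assumes "X \<in> Obj P" "A \<in> Obj P" "B \<in> Obj P" "h \<in> Hom P X (Prod P A B)"
  obtains f g where "f \<in> Hom P X A" "g \<in> Hom P X B" "h = pairing P X A B f g"
  using assms pairing_Fst_Snd_Comp[of X A B h] Comp_in_Hom Fst_in_Hom Snd_in_Hom Prod_in_Obj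
  by metis

lemma prod_arr_in_Hom [simp]:
  "\<lbrakk>A \<in> Obj P; B \<in> Obj P; C \<in> Obj P; D \<in> Obj P; f \<in> Hom P A C; g \<in> Hom P B D\<rbrakk>
    \<Longrightarrow> prod_arr P A B C D f g \<in> Hom P (Prod P A B) (Prod P C D)"
  by (simp add: prod_arr_def)

lemma proj_in_Hom [simp]:
  assumes "X \<in> Obj P" "A \<in> Obj P" "B \<in> Obj P"
  shows "proj1 P X A B \<in> Hom P (Prod3 P X A B) X"
    and "proj2 P X A B \<in> Hom P (Prod3 P X A B) A"
    and "proj3 P X A B \<in> Hom P (Prod3 P X A B) B"
    and "proj12 P X A B \<in> Hom P (Prod3 P X A B) (Prod P X A)"
    and "proj23 P X A B \<in> Hom P (Prod3 P X A B) (Prod P A B)"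
    and "proj13 P X A B \<in> Hom P (Prod3 P X A B) (Prod P X B)"
  using assms by (simp_all add: proj1_def proj2_def proj3_def proj12_def proj23_def proj13_def)

lemma proj_pairing [simp]:
  assumes "T \<in> Obj P" "X \<in> Obj P" "A \<in> Obj P" "B \<in> Obj P"
    and "x \<in> Hom P T X" "a \<in> Hom P T A" "b \<in> Hom P T B"
  defines "t \<equiv> pairing P T (Prod P X A) B (pairing P T X A x a) b"
  shows "Comp P T (Prod3 P X A B) (Prod P X A) (proj12 P X A B) t = pairing P T X A x a"
    and "Comp P T (Prod3 P X A B) (Prod P A B) (proj23 P X A B) t = pairing P T A B a b"
    and "Comp P T (Prod3 P X A B) (Prod P X B) (proj13 P X A B) t = pairing P T X B x b"
  using assms by (simp_all add: proj1_def proj2_def proj3_def proj12_def proj23_def proj13_def)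

lemma diag_in_Hom [simp]: "A \<in> Obj P \<Longrightarrow> diag P A \<in> Hom P A (Prod P A A)"
  by (simp add: diag_def)

lemma Comp_diag [simp]:
  "\<lbrakk>T \<in> Obj P; A \<in> Obj P; x \<in> Hom P T A\<rbrakk>
    \<Longrightarrow> Comp P T A (Prod P A A) (diag P A) x = pairing P T A A x x"
  by (simp add: diag_def)

lemma pdiag_in_Hom [simp]:
  "\<lbrakk>X \<in> Obj P; A \<in> Obj P\<rbrakk> \<Longrightarrow> pdiag P X A \<in> Hom P (Prod P X A) (Prod3 P X A A)"
  by (simp add: pdiag_def)

section \<open>Fibred equality\<close>

text \<open>
  Both adjunctions in the definition of fibred equality have this shape: \<open>d\<close> is a diagonal, \<open>p\<close> a
  projection that retracts it and \<open>\<epsilon>\<close> the equality, reindexed if there is a parameter.  The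
  condition on \<open>P\<^sub>d(\<epsilon>)\<close> says that the equality is reflexive and gives one direction; \<open>transport\<close>,
  substitution of equals, is the counit and gives the other.
\<close>

lemma galois_connection_reind_meet:
  assumes obj: "X \<in> Obj P" "Y \<in> Obj P" and p: "p \<in> Hom P Y X" and d: "d \<in> Hom P X Y"
    and retract: "Comp P X Y X p d = Ident P X"
    and \<epsilon>: "\<epsilon> \<in> carrier (Fib P Y)" "Reind P X Y d \<epsilon> = \<top>\<^bsub>Fib P X\<^esub>"
    and transport: "\<And>\<beta>. \<beta> \<in> carrier (Fib P Y) \<Longrightarrow>
      Reind P Y X p (Reind P X Y d \<beta>) \<sqinter>\<^bsub>Fib P Y\<^esub> \<epsilon> \<sqsubseteq>\<^bsub>Fib P Y\<^esub> \<beta>"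
  shows "galois_connection \<lparr>orderA = Fib P X, orderB = Fib P Y,
    lower = (\<lambda>\<alpha>. Reind P Y X p \<alpha> \<sqinter>\<^bsub>Fib P Y\<^esub> \<epsilon>), upper = Reind P X Y d\<rparr>"
proof -
  interpret FX: inf_semilattice "Fib P X" by (rule Fib_inf_semilattice[OF obj(1)])
  interpret FY: inf_semilattice "Fib P Y" by (rule Fib_inf_semilattice[OF obj(2)])
  have adj: "Reind P Y X p \<alpha> \<sqinter>\<^bsub>Fib P Y\<^esub> \<epsilon> \<sqsubseteq>\<^bsub>Fib P Y\<^esub> \<beta> \<longleftrightarrow> \<alpha> \<sqsubseteq>\<^bsub>Fib P X\<^esub> Reind P X Y d \<beta>"
    if \<alpha>: "\<alpha> \<in> carrier (Fib P X)" and \<beta>: "\<beta> \<in> carrier (Fib P Y)" for \<alpha> \<beta>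
  proof
    assume "Reind P Y X p \<alpha> \<sqinter>\<^bsub>Fib P Y\<^esub> \<epsilon> \<sqsubseteq>\<^bsub>Fib P Y\<^esub> \<beta>"
    then have "Reind P X Y d (Reind P Y X p \<alpha> \<sqinter>\<^bsub>Fib P Y\<^esub> \<epsilon>) \<sqsubseteq>\<^bsub>Fib P X\<^esub> Reind P X Y d \<beta>"
      using obj p d \<epsilon> \<alpha> \<beta> by (intro Reind_mono) simp_all
    then show "\<alpha> \<sqsubseteq>\<^bsub>Fib P X\<^esub> Reind P X Y d \<beta>"
      using obj p d \<epsilon> \<alpha> \<beta> retract by (simp add: FX.meet_top_eq)
  next
    assume "\<alpha> \<sqsubseteq>\<^bsub>Fib P X\<^esub> Reind P X Y d \<beta>"
    then have "Reind P Y X p \<alpha> \<sqsubseteq>\<^bsub>Fib P Y\<^esub> Reind P Y X p (Reind P X Y d \<beta>)"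
      by (rule Reind_mono[OF obj(2,1) p \<alpha> Reind_closed[OF obj d \<beta>]])
    then have "Reind P Y X p \<alpha> \<sqinter>\<^bsub>Fib P Y\<^esub> \<epsilon>
        \<sqsubseteq>\<^bsub>Fib P Y\<^esub> Reind P Y X p (Reind P X Y d \<beta>) \<sqinter>\<^bsub>Fib P Y\<^esub> \<epsilon>"
      using obj p d \<epsilon> \<alpha> \<beta> by (intro FY.meet_mono) (simp_all del: Reind_Comp[symmetric])
    then show "Reind P Y X p \<alpha> \<sqinter>\<^bsub>Fib P Y\<^esub> \<epsilon> \<sqsubseteq>\<^bsub>Fib P Y\<^esub> \<beta>"
      by (rule FY.le_trans[OF _ transport[OF \<beta>]]) (use obj p d \<epsilon> \<alpha> \<beta> in simp_all)
  qed
  show ?thesis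
    unfolding galois_connection_def connection_def galois_connection_axioms_def
    using FX.partial_order_axioms FY.partial_order_axioms obj p d \<epsilon> adj by auto
qed

text \<open>
  This is the adjunction at \<open>\<top>\<close>: \<open>\<delta>\<close> is the least reflexive relation, which makes it unique and
  reduces \<open>\<delta>\<^sub>A \<le> \<rho>\<close> to reflexivity.
\<close>

lemma is_fibred_equality_le_iff:
  assumes A: "A \<in> Obj P" and \<delta>: "is_fibred_equality P A \<delta>"
    and \<beta>: "\<beta> \<in> carrier (Fib P (Prod P A A))"
  shows "\<delta> \<sqsubseteq>\<^bsub>Fib P (Prod P A A)\<^esub> \<beta> \<longleftrightarrow> Reind P A (Prod P A A) (diag P A) \<beta> = \<top>\<^bsub>Fib P A\<^esub>"
proof -
  interpret FA: inf_semilattice "Fib P A" by (rule Fib_inf_semilattice[OF A])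
  interpret FAA: inf_semilattice "Fib P (Prod P A A)"
    by (rule Fib_inf_semilattice[OF Prod_in_Obj[OF A A]])
  have "galois_connection
       \<lparr>orderA = Fib P A, orderB = Fib P (Prod P A A),
        lower = (\<lambda>\<alpha>. Reind P (Prod P A A) A (Fst P A A) \<alpha> \<sqinter>\<^bsub>Fib P (Prod P A A)\<^esub> \<delta>),
        upper = Reind P A (Prod P A A) (diag P A)\<rparr>" and \<delta>': "\<delta> \<in> carrier (Fib P (Prod P A A))"
    using \<delta> by (simp_all add: is_fibred_equality_def)
  from galois_connection.galois_property[OF this(1), of "\<top>\<^bsub>Fib P A\<^esub>" \<beta>] show ?thesis
    using A \<beta> \<delta>' by (simp add: FAA.top_meet_eq FA.top_le_iff)
qed

lemma fib_eq_eqI: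
  assumes A: "A \<in> Obj P" and \<delta>: "is_fibred_equality P A \<delta>"
  shows "fib_eq P A = \<delta>"
  unfolding fib_eq_def
proof (rule the_equality[where P = "is_fibred_equality P A", OF \<delta>])
  fix \<delta>' assume \<delta>': "is_fibred_equality P A \<delta>'"
  interpret FAA: inf_semilattice "Fib P (Prod P A A)"
    by (rule Fib_inf_semilattice[OF Prod_in_Obj[OF A A]])
  have "\<delta> \<in> carrier (Fib P (Prod P A A))" "\<delta>' \<in> carrier (Fib P (Prod P A A))"
    using \<delta> \<delta>' by (simp_all add: is_fibred_equality_def)
  then show "\<delta>' = \<delta>"
    using is_fibred_equality_le_iff[OF A \<delta>] is_fibred_equality_le_iff[OF A \<delta>'] FAA.le_refl
    by (intro FAA.le_antisym) blast+
qed

end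


section \<open>Relations at generalized elements\<close>

text \<open>
  The truth value \<open>\<rho>(x, y)\<close> over \<open>T\<close>, for generalized elements \<open>x, y\<close> of \<open>A\<close> at stage \<open>T\<close>.
\<close>

abbreviation rel_at ::
  "('o, 'a, 'p, 'm) prod_indexed_poset_scheme \<Rightarrow> 'o \<Rightarrow> 'o \<Rightarrow> 'p \<Rightarrow> 'a \<Rightarrow> 'a \<Rightarrow> 'p" where
  "rel_at P T A \<rho> x y \<equiv> Reind P T (Prod P A A) (pairing P T A A x y) \<rho>"

context prod_indexed_inf_semilattice
begin

text \<open>
  The projections are the generic pair of elements: the inequality at them is the inequality itself,
  since their pairing is the identity.
\<close>

lemma Fib_Prod_le_iff:
  assumes obj: "A \<in> Obj P" "B \<in> Obj P"
    and \<beta>: "\<beta> \<in> carrier (Fib P (Prod P A B))" "\<beta>' \<in> carrier (Fib P (Prod P A B))"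
  shows "\<beta> \<sqsubseteq>\<^bsub>Fib P (Prod P A B)\<^esub> \<beta>' \<longleftrightarrow>
    (\<forall>T \<in> Obj P. \<forall>x \<in> Hom P T A. \<forall>y \<in> Hom P T B.
      Reind P T (Prod P A B) (pairing P T A B x y) \<beta>
        \<sqsubseteq>\<^bsub>Fib P T\<^esub> Reind P T (Prod P A B) (pairing P T A B x y) \<beta>')"
    (is "?le \<longleftrightarrow> ?pointwise")
proof
  assume ?le
  then show ?pointwise using obj \<beta> by (auto intro: Reind_mono)
next
  assume ?pointwise
  from this[rule_format, of "Prod P A B" "Fst P A B" "Snd P A B"] show ?le
    using obj \<beta> by simp
qed

lemma Des_carrier_iff:
  assumes A: "A \<in> Obj P" and \<rho>: "\<rho> \<in> carrier (Fib P (Prod P A A))"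
  shows "\<alpha> \<in> carrier (Des P A \<rho>) \<longleftrightarrow> \<alpha> \<in> carrier (Fib P A) \<and>
    (\<forall>T \<in> Obj P. \<forall>x \<in> Hom P T A. \<forall>y \<in> Hom P T A.
      Reind P T A x \<alpha> \<sqinter>\<^bsub>Fib P T\<^esub> rel_at P T A \<rho> x y \<sqsubseteq>\<^bsub>Fib P T\<^esub> Reind P T A y \<alpha>)"
proof -
  interpret FAA: inf_semilattice "Fib P (Prod P A A)"
    by (rule Fib_inf_semilattice[OF Prod_in_Obj[OF A A]])
  show ?thesis
    using A \<rho> by (simp add: Des_def Fib_Prod_le_iff cong: conj_cong)
qed

lemma le_Reind_prod_arr_iff:
  assumes "A \<in> Obj P" "B \<in> Obj P" "f \<in> Hom P A B" "g \<in> Hom P A B"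
    and "\<rho> \<in> carrier (Fib P (Prod P A A))" "\<sigma> \<in> carrier (Fib P (Prod P B B))"
  shows "\<rho> \<sqsubseteq>\<^bsub>Fib P (Prod P A A)\<^esub> Reind P (Prod P A A) (Prod P B B) (prod_arr P A A B B f g) \<sigma> \<longleftrightarrow>
    (\<forall>T \<in> Obj P. \<forall>x \<in> Hom P T A. \<forall>y \<in> Hom P T A.
      rel_at P T A \<rho> x y \<sqsubseteq>\<^bsub>Fib P T\<^esub> rel_at P T B \<sigma> (Comp P T A B f x) (Comp P T A B g y))"
  using assms by (simp add: Fib_Prod_le_iff prod_arr_def)

lemma le_Reind_swap_iff:
  assumes "A \<in> Obj P" "\<rho> \<in> carrier (Fib P (Prod P A A))"
  shows "\<rho> \<sqsubseteq>\<^bsub>Fib P (Prod P A A)\<^esub> Reind P (Prod P A A) (Prod P A A) (swap P A) \<rho> \<longleftrightarrow>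
    (\<forall>T \<in> Obj P. \<forall>x \<in> Hom P T A. \<forall>y \<in> Hom P T A.
      rel_at P T A \<rho> x y \<sqsubseteq>\<^bsub>Fib P T\<^esub> rel_at P T A \<rho> y x)"
  using assms by (simp add: Fib_Prod_le_iff swap_def)

lemma Reind_proj_transitive_iff:
  assumes A: "A \<in> Obj P" and \<rho>: "\<rho> \<in> carrier (Fib P (Prod P A A))"
  shows "Reind P (Prod3 P A A A) (Prod P A A) (proj12 P A A A) \<rho>
       \<sqinter>\<^bsub>Fib P (Prod3 P A A A)\<^esub> Reind P (Prod3 P A A A) (Prod P A A) (proj23 P A A A) \<rho>
       \<sqsubseteq>\<^bsub>Fib P (Prod3 P A A A)\<^esub> Reind P (Prod3 P A A A) (Prod P A A) (proj13 P A A A) \<rho> \<longleftrightarrow>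
    (\<forall>T \<in> Obj P. \<forall>x \<in> Hom P T A. \<forall>y \<in> Hom P T A. \<forall>z \<in> Hom P T A.
      rel_at P T A \<rho> x y \<sqinter>\<^bsub>Fib P T\<^esub> rel_at P T A \<rho> y z \<sqsubseteq>\<^bsub>Fib P T\<^esub> rel_at P T A \<rho> x z)"
    (is "?trans \<longleftrightarrow> ?pointwise")
proof -
  interpret F3: inf_semilattice "Fib P (Prod3 P A A A)"
    using A by (intro Fib_inf_semilattice) simp
  have split: "(\<forall>w \<in> Hom P T (Prod P A A). Q w)
      \<longleftrightarrow> (\<forall>x \<in> Hom P T A. \<forall>y \<in> Hom P T A. Q (pairing P T A A x y))"
    if T: "T \<in> Obj P" for T and Q :: "'a \<Rightarrow> bool"
    using T A by (auto elim!: Prod_arrow_cases[OF T A A])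
  show ?thesis
    using A \<rho> by (simp add: Fib_Prod_le_iff split)
qed

lemma prod_rel_closed [simp]:
  assumes "A \<in> Obj P" "B \<in> Obj P"
    and "\<rho> \<in> carrier (Fib P (Prod P A A))" "\<sigma> \<in> carrier (Fib P (Prod P B B))"
  shows "prod_rel P A B \<rho> \<sigma> \<in> carrier (Fib P (Prod P (Prod P A B) (Prod P A B)))"
proof -
  interpret F: inf_semilattice "Fib P (Prod P (Prod P A B) (Prod P A B))"
    using assms by (intro Fib_inf_semilattice) simp
  show ?thesis using assms by (simp add: prod_rel_def)
qed

lemma rel_at_prod_rel:
  assumes "T \<in> Obj P" "A \<in> Obj P" "B \<in> Obj P"
    and "\<rho> \<in> carrier (Fib P (Prod P A A))" "\<sigma> \<in> carrier (Fib P (Prod P B B))"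
    and "u \<in> Hom P T (Prod P A B)" "v \<in> Hom P T (Prod P A B)"
  shows "rel_at P T (Prod P A B) (prod_rel P A B \<rho> \<sigma>) u v =
    rel_at P T A \<rho> (Comp P T (Prod P A B) A (Fst P A B) u) (Comp P T (Prod P A B) A (Fst P A B) v)
    \<sqinter>\<^bsub>Fib P T\<^esub>
    rel_at P T B \<sigma> (Comp P T (Prod P A B) B (Snd P A B) u) (Comp P T (Prod P A B) B (Snd P A B) v)"
  using assms by (simp add: prod_rel_def prod_arr_def)

end

context elementary_doctrine
begin

lemma is_fibred_equality_fib_eq: "A \<in> Obj P \<Longrightarrow> is_fibred_equality P A (fib_eq P A)"
  using ex_fibred_equality fib_eq_eqI by blast

text \<open>
  Containing \<open>\<delta>\<^sub>A\<close> becomes reflexivity at all generalized elements, so that \<open>\<delta>\<close> disappears from the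
  description.
\<close>

lemma is_equiv_rel_iff:
  assumes A: "A \<in> Obj P"
  shows "is_equiv_rel P A \<rho> \<longleftrightarrow> \<rho> \<in> carrier (Fib P (Prod P A A)) \<and>
    (\<forall>T \<in> Obj P. \<forall>x \<in> Hom P T A. rel_at P T A \<rho> x x = \<top>\<^bsub>Fib P T\<^esub>) \<and>
    (\<forall>T \<in> Obj P. \<forall>x \<in> Hom P T A. \<forall>y \<in> Hom P T A.
      rel_at P T A \<rho> x y \<sqsubseteq>\<^bsub>Fib P T\<^esub> rel_at P T A \<rho> y x) \<and>
    (\<forall>T \<in> Obj P. \<forall>x \<in> Hom P T A. \<forall>y \<in> Hom P T A. \<forall>z \<in> Hom P T A.
      rel_at P T A \<rho> x y \<sqinter>\<^bsub>Fib P T\<^esub> rel_at P T A \<rho> y z \<sqsubseteq>\<^bsub>Fib P T\<^esub> rel_at P T A \<rho> x z)"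
proof -
  have refl: "Reind P A (Prod P A A) (diag P A) \<rho> = \<top>\<^bsub>Fib P A\<^esub> \<longleftrightarrow>
      (\<forall>T \<in> Obj P. \<forall>x \<in> Hom P T A. rel_at P T A \<rho> x x = \<top>\<^bsub>Fib P T\<^esub>)" (is "?d \<longleftrightarrow> ?pointwise")
    if \<rho>: "\<rho> \<in> carrier (Fib P (Prod P A A))"
  proof
    assume d: ?d
    have "rel_at P T A \<rho> x x = Reind P T A x (Reind P A (Prod P A A) (diag P A) \<rho>)"
      if "T \<in> Obj P" "x \<in> Hom P T A" for T x
      using that A \<rho> by simp
    with d A show ?pointwise by (simp del: Reind_Comp[symmetric])
  next
    assume ?pointwise
    then show ?d using A by (simp add: diag_def)
  qed
  show ?thesis
    using A by (auto simp: is_equiv_rel_def is_fibred_equality_le_iff[OF A is_fibred_equality_fib_eq]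
        le_Reind_swap_iff Reind_proj_transitive_iff refl)
qed

end

section \<open>The doctrine of descent data\<close>

lemma equiv_doctrine_simps [simp]:
  "(A, \<rho>) \<in> Obj (equiv_doctrine P) \<longleftrightarrow> A \<in> Obj P \<and> is_equiv_rel P A \<rho>"
  "Hom (equiv_doctrine P) = quot_arrows P"
  "Ident (equiv_doctrine P) (A, \<rho>) = Ident P A"
  "Comp (equiv_doctrine P) (A, \<rho>) (B, \<sigma>) (C, \<tau>) = Comp P A B C"
  "Fib (equiv_doctrine P) (A, \<rho>) = Des P A \<rho>"
  "Reind (equiv_doctrine P) (A, \<rho>) (B, \<sigma>) = Reind P A B"
  "Prod (equiv_doctrine P) (A, \<rho>) (B, \<sigma>) = (Prod P A B, prod_rel P A B \<rho> \<sigma>)"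
  "Fst (equiv_doctrine P) (A, \<rho>) (B, \<sigma>) = Fst P A B"
  "Snd (equiv_doctrine P) (A, \<rho>) (B, \<sigma>) = Snd P A B"
  by (simp_all add: equiv_doctrine_def quot_arrows_def)

lemma le_Des [simp]: "le (Des P A \<rho>) = le (Fib P A)"
  by (simp add: Des_def)

lemma Des_eq: "Des P A \<rho> = (Fib P A)\<lparr>carrier := carrier (Des P A \<rho>)\<rparr>"
  by (simp add: Des_def)

context elementary_doctrine
begin

lemma equiv_rel_closed [simp]:
  "is_equiv_rel P A \<rho> \<Longrightarrow> \<rho> \<in> carrier (Fib P (Prod P A A))"
  by (simp add: is_equiv_rel_def)

lemma equiv_rel_refl:
  "\<lbrakk>is_equiv_rel P A \<rho>; A \<in> Obj P; T \<in> Obj P; x \<in> Hom P T A\<rbrakk> \<Longrightarrow> rel_at P T A \<rho> x x = \<top>\<^bsub>Fib P T\<^esub>"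
  by (simp add: is_equiv_rel_iff)

lemma equiv_rel_sym:
  "\<lbrakk>is_equiv_rel P A \<rho>; A \<in> Obj P; T \<in> Obj P; x \<in> Hom P T A; y \<in> Hom P T A\<rbrakk>
    \<Longrightarrow> rel_at P T A \<rho> x y \<sqsubseteq>\<^bsub>Fib P T\<^esub> rel_at P T A \<rho> y x"
  by (simp add: is_equiv_rel_iff)

lemma equiv_rel_trans:
  "\<lbrakk>is_equiv_rel P A \<rho>; A \<in> Obj P; T \<in> Obj P; x \<in> Hom P T A; y \<in> Hom P T A; z \<in> Hom P T A\<rbrakk>
    \<Longrightarrow> rel_at P T A \<rho> x y \<sqinter>\<^bsub>Fib P T\<^esub> rel_at P T A \<rho> y z \<sqsubseteq>\<^bsub>Fib P T\<^esub> rel_at P T A \<rho> x z"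
  by (simp add: is_equiv_rel_iff)

text \<open>
  As a rewrite rule this is declared only now: together with \<open>is_equiv_rel_iff\<close> in the simplifier, its
  premise would unfold to an instance of its own conclusion and rewriting would not terminate.
\<close>

declare equiv_rel_refl [simp]

lemma quot_arrows_iff:
  assumes "A \<in> Obj P" "B \<in> Obj P" "is_equiv_rel P A \<rho>" "is_equiv_rel P B \<sigma>"
  shows "f \<in> quot_arrows P (A, \<rho>) (B, \<sigma>) \<longleftrightarrow> f \<in> Hom P A B \<and>
    (\<forall>T \<in> Obj P. \<forall>x \<in> Hom P T A. \<forall>y \<in> Hom P T A.
      rel_at P T A \<rho> x y \<sqsubseteq>\<^bsub>Fib P T\<^esub> rel_at P T B \<sigma> (Comp P T A B f x) (Comp P T A B f y))"
  using assms le_Reind_prod_arr_iff[of A B f f \<rho> \<sigma>] by (auto simp: quot_arrows_def)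

lemma quot_arrows_in_Hom: "f \<in> quot_arrows P (A, \<rho>) (B, \<sigma>) \<Longrightarrow> f \<in> Hom P A B"
  by (simp add: quot_arrows_def)

lemma quot_arrows_le:
  assumes "f \<in> quot_arrows P (A, \<rho>) (B, \<sigma>)"
    and "A \<in> Obj P" "B \<in> Obj P" "is_equiv_rel P A \<rho>" "is_equiv_rel P B \<sigma>"
    and "T \<in> Obj P" "x \<in> Hom P T A" "y \<in> Hom P T A"
  shows "rel_at P T A \<rho> x y \<sqsubseteq>\<^bsub>Fib P T\<^esub> rel_at P T B \<sigma> (Comp P T A B f x) (Comp P T A B f y)"
  using assms by (simp add: quot_arrows_iff)

lemma Des_closed: "\<alpha> \<in> carrier (Des P A \<rho>) \<Longrightarrow> \<alpha> \<in> carrier (Fib P A)"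
  by (simp add: Des_def)

lemma Des_descent:
  assumes "\<alpha> \<in> carrier (Des P A \<rho>)" "A \<in> Obj P" "\<rho> \<in> carrier (Fib P (Prod P A A))"
    and "T \<in> Obj P" "x \<in> Hom P T A" "y \<in> Hom P T A"
  shows "Reind P T A x \<alpha> \<sqinter>\<^bsub>Fib P T\<^esub> rel_at P T A \<rho> x y \<sqsubseteq>\<^bsub>Fib P T\<^esub> Reind P T A y \<alpha>"
  using assms by (simp add: Des_carrier_iff)

lemma
  assumes A: "A \<in> Obj P" and \<rho>: "is_equiv_rel P A \<rho>"
  shows inf_semilattice_Des: "inf_semilattice (Des P A \<rho>)"
    and top_Des: "\<top>\<^bsub>Des P A \<rho>\<^esub> = \<top>\<^bsub>Fib P A\<^esub>"
    and meet_Des: "\<lbrakk>\<alpha> \<in> carrier (Des P A \<rho>); \<beta> \<in> carrier (Des P A \<rho>)\<rbrakk>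
      \<Longrightarrow> \<alpha> \<sqinter>\<^bsub>Des P A \<rho>\<^esub> \<beta> = \<alpha> \<sqinter>\<^bsub>Fib P A\<^esub> \<beta>"
proof -
  interpret FA: inf_semilattice "Fib P A" by (rule Fib_inf_semilattice[OF A])
  have top: "\<top>\<^bsub>Fib P A\<^esub> \<in> carrier (Des P A \<rho>)"
    unfolding Des_carrier_iff[OF A equiv_rel_closed[OF \<rho>]]
  proof (intro conjI ballI)
    fix T x y assume T: "T \<in> Obj P" "x \<in> Hom P T A" "y \<in> Hom P T A"
    interpret FT: inf_semilattice "Fib P T" by (rule Fib_inf_semilattice[OF T(1)])
    show "Reind P T A x \<top>\<^bsub>Fib P A\<^esub> \<sqinter>\<^bsub>Fib P T\<^esub> rel_at P T A \<rho> x y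
        \<sqsubseteq>\<^bsub>Fib P T\<^esub> Reind P T A y \<top>\<^bsub>Fib P A\<^esub>"
      using T A \<rho> by simp
  qed simp
  have meet: "\<alpha> \<sqinter>\<^bsub>Fib P A\<^esub> \<beta> \<in> carrier (Des P A \<rho>)"
    if "\<alpha> \<in> carrier (Des P A \<rho>)" "\<beta> \<in> carrier (Des P A \<rho>)" for \<alpha> \<beta>
    unfolding Des_carrier_iff[OF A equiv_rel_closed[OF \<rho>]]
  proof (intro conjI ballI)
    fix T x y assume T: "T \<in> Obj P" "x \<in> Hom P T A" "y \<in> Hom P T A"
    interpret FT: inf_semilattice "Fib P T" by (rule Fib_inf_semilattice[OF T(1)])
    let ?r = "rel_at P T A \<rho> x y"
    have cl: "Reind P T A x \<alpha> \<in> carrier (Fib P T)" "Reind P T A x \<beta> \<in> carrier (Fib P T)"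
      "Reind P T A y \<alpha> \<in> carrier (Fib P T)" "Reind P T A y \<beta> \<in> carrier (Fib P T)"
      "?r \<in> carrier (Fib P T)"
      using T A \<rho> that[THEN Des_closed] by simp_all
    have "Reind P T A x \<alpha> \<sqinter>\<^bsub>Fib P T\<^esub> ?r \<sqsubseteq>\<^bsub>Fib P T\<^esub> Reind P T A y \<alpha>"
      "Reind P T A x \<beta> \<sqinter>\<^bsub>Fib P T\<^esub> ?r \<sqsubseteq>\<^bsub>Fib P T\<^esub> Reind P T A y \<beta>"
      using that T A \<rho> by (auto intro: Des_descent)
    then have "(Reind P T A x \<alpha> \<sqinter>\<^bsub>Fib P T\<^esub> Reind P T A x \<beta>) \<sqinter>\<^bsub>Fib P T\<^esub> (?r \<sqinter>\<^bsub>Fib P T\<^esub> ?r)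
        \<sqsubseteq>\<^bsub>Fib P T\<^esub> Reind P T A y \<alpha> \<sqinter>\<^bsub>Fib P T\<^esub> Reind P T A y \<beta>"
      using cl by (intro FT.meet_interchange_le)
    then show "Reind P T A x (\<alpha> \<sqinter>\<^bsub>Fib P A\<^esub> \<beta>) \<sqinter>\<^bsub>Fib P T\<^esub> ?r
        \<sqsubseteq>\<^bsub>Fib P T\<^esub> Reind P T A y (\<alpha> \<sqinter>\<^bsub>Fib P A\<^esub> \<beta>)"
      using T A cl that[THEN Des_closed] by (simp add: FT.meet_idem)
  qed (use that[THEN Des_closed] in simp)
  have sub: "carrier (Des P A \<rho>) \<subseteq> carrier (Fib P A)" by (auto dest: Des_closed)
  show "inf_semilattice (Des P A \<rho>)" "\<top>\<^bsub>Des P A \<rho>\<^esub> = \<top>\<^bsub>Fib P A\<^esub>"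
    using FA.inf_semilattice_subset[OF sub top meet] FA.top_subset[OF sub top meet]
    by (simp_all flip: Des_eq)
  show "\<alpha> \<sqinter>\<^bsub>Des P A \<rho>\<^esub> \<beta> = \<alpha> \<sqinter>\<^bsub>Fib P A\<^esub> \<beta>"
    if "\<alpha> \<in> carrier (Des P A \<rho>)" "\<beta> \<in> carrier (Des P A \<rho>)"
    using FA.meet_subset[OF sub top meet that] by (simp flip: Des_eq)
qed

text \<open>
  In terms of elements: \<open>\<beta>(f x)\<close> and \<open>\<rho>(x, y)\<close> give \<open>\<sigma>(f x, f y)\<close>, hence \<open>\<beta>(f y)\<close>.
\<close>

lemma Reind_Des:
  assumes f: "f \<in> quot_arrows P (A, \<rho>) (B, \<sigma>)" and \<beta>: "\<beta> \<in> carrier (Des P B \<sigma>)"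
    and obj: "A \<in> Obj P" "B \<in> Obj P" "is_equiv_rel P A \<rho>" "is_equiv_rel P B \<sigma>"
  shows "Reind P A B f \<beta> \<in> carrier (Des P A \<rho>)"
  unfolding Des_carrier_iff[OF obj(1) equiv_rel_closed[OF obj(3)]]
proof (intro conjI ballI)
  note fH = quot_arrows_in_Hom[OF f] and \<beta>F = Des_closed[OF \<beta>]
  show "Reind P A B f \<beta> \<in> carrier (Fib P A)" using obj fH \<beta>F by simp
  fix T x y assume T: "T \<in> Obj P" "x \<in> Hom P T A" "y \<in> Hom P T A"
  interpret FT: inf_semilattice "Fib P T" by (rule Fib_inf_semilattice[OF T(1)])
  let ?fx = "Comp P T A B f x" and ?fy = "Comp P T A B f y"
  have "Reind P T B ?fx \<beta> \<sqinter>\<^bsub>Fib P T\<^esub> rel_at P T A \<rho> x y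
      \<sqsubseteq>\<^bsub>Fib P T\<^esub> Reind P T B ?fx \<beta> \<sqinter>\<^bsub>Fib P T\<^esub> rel_at P T B \<sigma> ?fx ?fy"
    using quot_arrows_le[OF f obj T] obj T fH \<beta>F by (intro FT.meet_mono) simp_all
  moreover have "Reind P T B ?fx \<beta> \<sqinter>\<^bsub>Fib P T\<^esub> rel_at P T B \<sigma> ?fx ?fy \<sqsubseteq>\<^bsub>Fib P T\<^esub> Reind P T B ?fy \<beta>"
    using \<beta> obj T fH by (intro Des_descent) simp_all
  ultimately have "Reind P T B ?fx \<beta> \<sqinter>\<^bsub>Fib P T\<^esub> rel_at P T A \<rho> x y \<sqsubseteq>\<^bsub>Fib P T\<^esub> Reind P T B ?fy \<beta>"
    by (rule FT.le_trans) (use obj T fH \<beta>F in simp_all)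
  then show "Reind P T A x (Reind P A B f \<beta>) \<sqinter>\<^bsub>Fib P T\<^esub> rel_at P T A \<rho> x y
      \<sqsubseteq>\<^bsub>Fib P T\<^esub> Reind P T A y (Reind P A B f \<beta>)"
    using obj T fH \<beta>F by simp
qed

lemma is_equiv_rel_prod_rel [simp]:
  assumes obj: "A \<in> Obj P" "B \<in> Obj P" and eq: "is_equiv_rel P A \<rho>" "is_equiv_rel P B \<sigma>"
  shows "is_equiv_rel P (Prod P A B) (prod_rel P A B \<rho> \<sigma>)"
  unfolding is_equiv_rel_iff[OF Prod_in_Obj[OF obj]]
proof (intro conjI ballI)
  show "prod_rel P A B \<rho> \<sigma> \<in> carrier (Fib P (Prod P (Prod P A B) (Prod P A B)))"
    using obj eq by simp
next
  fix T u assume T: "T \<in> Obj P" and u: "u \<in> Hom P T (Prod P A B)"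
  interpret FT: inf_semilattice "Fib P T" by (rule Fib_inf_semilattice[OF T])
  show "rel_at P T (Prod P A B) (prod_rel P A B \<rho> \<sigma>) u u = \<top>\<^bsub>Fib P T\<^esub>"
    using T u obj eq by (simp add: rel_at_prod_rel FT.top_meet_eq)
next
  fix T u v
  assume T: "T \<in> Obj P" and u: "u \<in> Hom P T (Prod P A B)" and v: "v \<in> Hom P T (Prod P A B)"
  interpret FT: inf_semilattice "Fib P T" by (rule Fib_inf_semilattice[OF T])
  show "rel_at P T (Prod P A B) (prod_rel P A B \<rho> \<sigma>) u v
      \<sqsubseteq>\<^bsub>Fib P T\<^esub> rel_at P T (Prod P A B) (prod_rel P A B \<rho> \<sigma>) v u"
    using T u v obj eq by (simp add: rel_at_prod_rel FT.meet_mono equiv_rel_sym)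
next
  fix T u v w
  assume T: "T \<in> Obj P" and u: "u \<in> Hom P T (Prod P A B)" and v: "v \<in> Hom P T (Prod P A B)"
    and w: "w \<in> Hom P T (Prod P A B)"
  interpret FT: inf_semilattice "Fib P T" by (rule Fib_inf_semilattice[OF T])
  show "rel_at P T (Prod P A B) (prod_rel P A B \<rho> \<sigma>) u v
      \<sqinter>\<^bsub>Fib P T\<^esub> rel_at P T (Prod P A B) (prod_rel P A B \<rho> \<sigma>) v w
      \<sqsubseteq>\<^bsub>Fib P T\<^esub> rel_at P T (Prod P A B) (prod_rel P A B \<rho> \<sigma>) u w"
    using T u v w obj eq by (simp add: rel_at_prod_rel FT.meet_interchange_le equiv_rel_trans)
qed

lemma Ident_in_quot_arrows:
  "\<lbrakk>A \<in> Obj P; is_equiv_rel P A \<rho>\<rbrakk> \<Longrightarrow> Ident P A \<in> quot_arrows P (A, \<rho>) (A, \<rho>)"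
  by (simp add: quot_arrows_iff)

lemma Comp_in_quot_arrows:
  assumes obj: "A \<in> Obj P" "B \<in> Obj P" "C \<in> Obj P"
    and eq: "is_equiv_rel P A \<rho>" "is_equiv_rel P B \<sigma>" "is_equiv_rel P C \<tau>"
    and f: "f \<in> quot_arrows P (A, \<rho>) (B, \<sigma>)" and g: "g \<in> quot_arrows P (B, \<sigma>) (C, \<tau>)"
  shows "Comp P A B C g f \<in> quot_arrows P (A, \<rho>) (C, \<tau>)"
  unfolding quot_arrows_iff[OF obj(1,3) eq(1,3)]
proof (intro conjI ballI)
  note H = quot_arrows_in_Hom[OF f] quot_arrows_in_Hom[OF g]
  show "Comp P A B C g f \<in> Hom P A C" using H obj by simp
  fix T x y assume T: "T \<in> Obj P" "x \<in> Hom P T A" "y \<in> Hom P T A"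
  interpret FT: inf_semilattice "Fib P T" by (rule Fib_inf_semilattice[OF T(1)])
  have "rel_at P T A \<rho> x y \<sqsubseteq>\<^bsub>Fib P T\<^esub> rel_at P T B \<sigma> (Comp P T A B f x) (Comp P T A B f y)"
    by (rule quot_arrows_le[OF f obj(1,2) eq(1,2) T])
  also have "\<dots> \<sqsubseteq>\<^bsub>Fib P T\<^esub> rel_at P T C \<tau> (Comp P T B C g (Comp P T A B f x))
      (Comp P T B C g (Comp P T A B f y))"
    using obj T H by (intro quot_arrows_le[OF g obj(2,3) eq(2,3)]) simp_all
  finally show "rel_at P T A \<rho> x y \<sqsubseteq>\<^bsub>Fib P T\<^esub>
      rel_at P T C \<tau> (Comp P T A C (Comp P A B C g f) x) (Comp P T A C (Comp P A B C g f) y)"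
    using obj eq T H by simp
qed

lemma
  assumes obj: "A \<in> Obj P" "B \<in> Obj P" and eq: "is_equiv_rel P A \<rho>" "is_equiv_rel P B \<sigma>"
  shows Fst_in_quot_arrows: "Fst P A B \<in> quot_arrows P (Prod P A B, prod_rel P A B \<rho> \<sigma>) (A, \<rho>)"
    and Snd_in_quot_arrows: "Snd P A B \<in> quot_arrows P (Prod P A B, prod_rel P A B \<rho> \<sigma>) (B, \<sigma>)"
proof -
  have meet_bounds: "a \<sqinter>\<^bsub>Fib P T\<^esub> b \<sqsubseteq>\<^bsub>Fib P T\<^esub> a" "a \<sqinter>\<^bsub>Fib P T\<^esub> b \<sqsubseteq>\<^bsub>Fib P T\<^esub> b"
    if "T \<in> Obj P" "a \<in> carrier (Fib P T)" "b \<in> carrier (Fib P T)" for T a b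
  proof -
    interpret FT: inf_semilattice "Fib P T" by (rule Fib_inf_semilattice[OF that(1)])
    show "a \<sqinter>\<^bsub>Fib P T\<^esub> b \<sqsubseteq>\<^bsub>Fib P T\<^esub> a" "a \<sqinter>\<^bsub>Fib P T\<^esub> b \<sqsubseteq>\<^bsub>Fib P T\<^esub> b"
      using that by (simp_all add: FT.meet_left FT.meet_right)
  qed
  show "Fst P A B \<in> quot_arrows P (Prod P A B, prod_rel P A B \<rho> \<sigma>) (A, \<rho>)"
    "Snd P A B \<in> quot_arrows P (Prod P A B, prod_rel P A B \<rho> \<sigma>) (B, \<sigma>)"
    using obj eq by (simp_all add: quot_arrows_iff rel_at_prod_rel meet_bounds)
qed

lemma pairing_in_quot_arrows:
  assumes obj: "X \<in> Obj P" "A \<in> Obj P" "B \<in> Obj P"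
    and eq: "is_equiv_rel P X \<tau>" "is_equiv_rel P A \<rho>" "is_equiv_rel P B \<sigma>"
    and f: "f \<in> quot_arrows P (X, \<tau>) (A, \<rho>)" and g: "g \<in> quot_arrows P (X, \<tau>) (B, \<sigma>)"
  shows "pairing P X A B f g \<in> quot_arrows P (X, \<tau>) (Prod P A B, prod_rel P A B \<rho> \<sigma>)"
  unfolding quot_arrows_iff[OF obj(1) Prod_in_Obj[OF obj(2,3)] eq(1)
      is_equiv_rel_prod_rel[OF obj(2,3) eq(2,3)]]
proof (intro conjI ballI)
  note H = quot_arrows_in_Hom[OF f] quot_arrows_in_Hom[OF g]
  show "pairing P X A B f g \<in> Hom P X (Prod P A B)" using H obj by simp
  fix T x y assume T: "T \<in> Obj P" "x \<in> Hom P T X" "y \<in> Hom P T X"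
  interpret FT: inf_semilattice "Fib P T" by (rule Fib_inf_semilattice[OF T(1)])
  show "rel_at P T X \<tau> x y \<sqsubseteq>\<^bsub>Fib P T\<^esub> rel_at P T (Prod P A B) (prod_rel P A B \<rho> \<sigma>)
      (Comp P T X (Prod P A B) (pairing P X A B f g) x)
      (Comp P T X (Prod P A B) (pairing P X A B f g) y)"
    using obj eq T H quot_arrows_le[OF f obj(1,2) eq(1,2) T] quot_arrows_le[OF g obj(1,3) eq(1,3) T]
    by (simp add: rel_at_prod_rel FT.le_meet_iff)
qed

text \<open>
  This gives for descent data the calculus of pairings, the uniqueness of fibred equality and the
  criterion \<open>galois_connection_reind_meet\<close>.
\<close>

lemma prod_indexed_inf_semilattice_equiv_doctrine:
  "prod_indexed_inf_semilattice (equiv_doctrine P)"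
proof (intro prod_indexed_inf_semilattice.intro prod_indexed_inf_semilattice_axioms.intro
    indexed_inf_semilattice.intro indexed_inf_semilattice_axioms.intro category.intro, goal_cases)
  case (1 X)
  then show ?case by (cases X) (simp add: Ident_in_quot_arrows)
next
  case (2 X Y Z f g)
  then show ?case by (cases X, cases Y, cases Z) (auto intro: Comp_in_quot_arrows)
next
  case (3 X Y f)
  then show ?case by (cases X, cases Y) (simp add: quot_arrows_in_Hom)
next
  case (4 X Y f)
  then show ?case by (cases X, cases Y) (simp add: quot_arrows_in_Hom)
next
  case (5 W X Y Z f g h)
  then show ?case by (cases W, cases X, cases Y, cases Z) (simp add: quot_arrows_in_Hom)
next
  case (6 X)
  then show ?case by (cases X) (simp add: inf_semilattice_Des)
next
  case (7 X Y f)
  obtain A \<rho> B \<sigma> where XY: "X = (A, \<rho>)" "Y = (B, \<sigma>)" by (cases X, cases Y)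
  with 7 have obj: "A \<in> Obj P" "B \<in> Obj P" "is_equiv_rel P A \<rho>" "is_equiv_rel P B \<sigma>"
    and f: "f \<in> quot_arrows P (A, \<rho>) (B, \<sigma>)" by simp_all
  show ?case
    using obj quot_arrows_in_Hom[OF f] Reind_Des[OF f _ obj]
    by (auto simp: XY inf_hom_def top_Des meet_Des Des_closed)
next
  case (8 X \<alpha>)
  then show ?case by (cases X) (simp add: Des_closed)
next
  case (9 X Y Z f g \<alpha>)
  then show ?case by (cases X, cases Y, cases Z) (simp add: quot_arrows_in_Hom Des_closed)
next
  case (10 A B)
  then show ?case by (cases A, cases B) simp
next
  case (11 A B)
  then show ?case by (cases A, cases B) (simp add: Fst_in_quot_arrows)
next
  case (12 A B)
  then show ?case by (cases A, cases B) (simp add: Snd_in_quot_arrows)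
next
  case (13 X A B f g)
  obtain X0 \<tau> A0 \<rho> B0 \<sigma> where XAB: "X = (X0, \<tau>)" "A = (A0, \<rho>)" "B = (B0, \<sigma>)"
    by (cases X, cases A, cases B)
  with 13 have obj: "X0 \<in> Obj P" "A0 \<in> Obj P" "B0 \<in> Obj P"
    and eq: "is_equiv_rel P X0 \<tau>" "is_equiv_rel P A0 \<rho>" "is_equiv_rel P B0 \<sigma>"
    and f: "f \<in> quot_arrows P (X0, \<tau>) (A0, \<rho>)" and g: "g \<in> quot_arrows P (X0, \<tau>) (B0, \<sigma>)"
    by simp_all
  note H = quot_arrows_in_Hom[OF f] quot_arrows_in_Hom[OF g]
  show ?case
  proof (rule ex1I)
    show "is_pairing (equiv_doctrine P) X A B f g (pairing P X0 A0 B0 f g)"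
      using obj H pairing_in_quot_arrows[OF obj eq f g] by (simp add: XAB is_pairing_def)
  next
    fix h assume "is_pairing (equiv_doctrine P) X A B f g h"
    then have "is_pairing P X0 A0 B0 f g h"
      by (auto simp: XAB is_pairing_def dest: quot_arrows_in_Hom)
    then show "h = pairing P X0 A0 B0 f g"
      using pairing_eqI[OF obj H] by simp
  qed
qed

end

section \<open>Fibred equality on descent data\<close>

context elementary_doctrine
begin

text \<open>
  Arrows of \<open>\<R>\<^sub>P\<close> are arrows of the base, so the pairing in the base satisfies the equations that
  determine the pairing in \<open>\<R>\<^sub>P\<close>.  The arrows built from pairings are therefore the same in both.
\<close>

lemma pairing_equiv_doctrine:
  assumes obj: "X \<in> Obj P" "A \<in> Obj P" "B \<in> Obj P"
    and eq: "is_equiv_rel P X \<tau>" "is_equiv_rel P A \<rho>" "is_equiv_rel P B \<sigma>"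
    and f: "f \<in> quot_arrows P (X, \<tau>) (A, \<rho>)" and g: "g \<in> quot_arrows P (X, \<tau>) (B, \<sigma>)"
  shows "pairing (equiv_doctrine P) (X, \<tau>) (A, \<rho>) (B, \<sigma>) f g = pairing P X A B f g"
proof -
  interpret E: prod_indexed_inf_semilattice "equiv_doctrine P"
    by (rule prod_indexed_inf_semilattice_equiv_doctrine)
  show ?thesis
  proof (rule E.pairing_eqI)
    show "is_pairing (equiv_doctrine P) (X, \<tau>) (A, \<rho>) (B, \<sigma>) f g (pairing P X A B f g)"
      using obj quot_arrows_in_Hom[OF f] quot_arrows_in_Hom[OF g] pairing_in_quot_arrows[OF obj eq f g]
      by (simp add: is_pairing_def)
  qed (use obj eq f g in simp_all)
qed

lemma prod_arr_equiv_doctrine: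
  assumes obj: "A \<in> Obj P" "B \<in> Obj P" and eq: "is_equiv_rel P A \<rho>" "is_equiv_rel P B \<sigma>"
    and f: "f \<in> quot_arrows P (A, \<rho>) (B, \<sigma>)" and g: "g \<in> quot_arrows P (A, \<rho>) (B, \<sigma>)"
  shows "prod_arr (equiv_doctrine P) (A, \<rho>) (A, \<rho>) (B, \<sigma>) (B, \<sigma>) f g = prod_arr P A A B B f g"
  unfolding prod_arr_def equiv_doctrine_simps
  by (rule pairing_equiv_doctrine)
    (use assms in \<open>auto intro: Comp_in_quot_arrows Fst_in_quot_arrows Snd_in_quot_arrows\<close>)

lemma diag_equiv_doctrine:
  "\<lbrakk>A \<in> Obj P; is_equiv_rel P A \<rho>\<rbrakk> \<Longrightarrow> diag (equiv_doctrine P) (A, \<rho>) = diag P A"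
  by (simp add: diag_def pairing_equiv_doctrine Ident_in_quot_arrows)

lemma
  assumes obj: "X \<in> Obj P" "A \<in> Obj P" "B \<in> Obj P"
    and eq: "is_equiv_rel P X \<tau>" "is_equiv_rel P A \<rho>" "is_equiv_rel P B \<sigma>"
  shows proj12_equiv_doctrine: "proj12 (equiv_doctrine P) (X, \<tau>) (A, \<rho>) (B, \<sigma>) = proj12 P X A B"
    and proj23_equiv_doctrine: "proj23 (equiv_doctrine P) (X, \<tau>) (A, \<rho>) (B, \<sigma>) = proj23 P X A B"
proof -
  interpret E: prod_indexed_inf_semilattice "equiv_doctrine P"
    by (rule prod_indexed_inf_semilattice_equiv_doctrine)
  have eqs: "proj1 (equiv_doctrine P) (X, \<tau>) (A, \<rho>) (B, \<sigma>) = proj1 P X A B"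
    "proj2 (equiv_doctrine P) (X, \<tau>) (A, \<rho>) (B, \<sigma>) = proj2 P X A B"
    "proj3 (equiv_doctrine P) (X, \<tau>) (A, \<rho>) (B, \<sigma>) = proj3 P X A B"
    by (simp_all add: proj1_def proj2_def proj3_def)
  have "proj1 P X A B \<in> quot_arrows P (Prod3 P X A B, prod_rel P (Prod P X A) B (prod_rel P X A \<tau> \<rho>) \<sigma>) (X, \<tau>)"
    "proj2 P X A B \<in> quot_arrows P (Prod3 P X A B, prod_rel P (Prod P X A) B (prod_rel P X A \<tau> \<rho>) \<sigma>) (A, \<rho>)"
    "proj3 P X A B \<in> quot_arrows P (Prod3 P X A B, prod_rel P (Prod P X A) B (prod_rel P X A \<tau> \<rho>) \<sigma>) (B, \<sigma>)"
    using E.proj_in_Hom(1-3)[of "(X, \<tau>)" "(A, \<rho>)" "(B, \<sigma>)"] obj eq by (simp_all add: eqs)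
  then show "proj12 (equiv_doctrine P) (X, \<tau>) (A, \<rho>) (B, \<sigma>) = proj12 P X A B"
    and "proj23 (equiv_doctrine P) (X, \<tau>) (A, \<rho>) (B, \<sigma>) = proj23 P X A B"
    using obj eq by (simp_all add: proj12_def proj23_def eqs pairing_equiv_doctrine)
qed

lemma pdiag_equiv_doctrine:
  assumes "X \<in> Obj P" "A \<in> Obj P" "is_equiv_rel P X \<tau>" "is_equiv_rel P A \<rho>"
  shows "pdiag (equiv_doctrine P) (X, \<tau>) (A, \<rho>) = pdiag P X A"
  using assms Ident_in_quot_arrows[of "Prod P X A" "prod_rel P X A \<tau> \<rho>"]
  by (simp add: pdiag_def pairing_equiv_doctrine Fst_in_quot_arrows Snd_in_quot_arrows)

text \<open>
  From \<open>\<rho>(x, y)\<close>, \<open>\<rho>(x, x')\<close> and \<open>\<rho>(y, y')\<close> follows \<open>\<rho>(x', y')\<close>, through \<open>x'\<close>, \<open>x\<close>, \<open>y\<close>, \<open>y'\<close>.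
\<close>

lemma equiv_rel_in_Des:
  assumes A: "A \<in> Obj P" and \<rho>: "is_equiv_rel P A \<rho>"
  shows "\<rho> \<in> carrier (Des P (Prod P A A) (prod_rel P A A \<rho> \<rho>))"
  unfolding Des_carrier_iff[OF Prod_in_Obj[OF A A]
      equiv_rel_closed[OF is_equiv_rel_prod_rel[OF A A \<rho> \<rho>]]]
proof (intro conjI ballI)
  fix T u v assume T: "T \<in> Obj P" and uv: "u \<in> Hom P T (Prod P A A)" "v \<in> Hom P T (Prod P A A)"
  interpret FT: inf_semilattice "Fib P T" by (rule Fib_inf_semilattice[OF T])
  obtain x y where u: "x \<in> Hom P T A" "y \<in> Hom P T A" "u = pairing P T A A x y"
    using Prod_arrow_cases[OF T A A uv(1)] .
  obtain x' y' where v: "x' \<in> Hom P T A" "y' \<in> Hom P T A" "v = pairing P T A A x' y'"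
    using Prod_arrow_cases[OF T A A uv(2)] .
  let ?r = "rel_at P T A \<rho>"
  have cl: "?r s t \<in> carrier (Fib P T)" if "s \<in> Hom P T A" "t \<in> Hom P T A" for s t
    using that T A \<rho> by simp
  define m where "m = ?r x y \<sqinter>\<^bsub>Fib P T\<^esub> (?r x x' \<sqinter>\<^bsub>Fib P T\<^esub> ?r y y')"
  have m: "m \<in> carrier (Fib P T)" unfolding m_def using u v by (simp add: cl)
  have m_le: "m \<sqsubseteq>\<^bsub>Fib P T\<^esub> ?r x y" "m \<sqsubseteq>\<^bsub>Fib P T\<^esub> ?r x x'" "m \<sqsubseteq>\<^bsub>Fib P T\<^esub> ?r y y'"
    unfolding m_def using u v by (simp_all add: cl FT.meet_left FT.meet_le_right FT.meet_right)
  have trans: "m \<sqsubseteq>\<^bsub>Fib P T\<^esub> ?r a c"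
    if "m \<sqsubseteq>\<^bsub>Fib P T\<^esub> ?r a b" "m \<sqsubseteq>\<^bsub>Fib P T\<^esub> ?r b c"
      "a \<in> Hom P T A" "b \<in> Hom P T A" "c \<in> Hom P T A" for a b c
  proof (rule FT.le_trans)
    show "m \<sqsubseteq>\<^bsub>Fib P T\<^esub> ?r a b \<sqinter>\<^bsub>Fib P T\<^esub> ?r b c" using that m by (simp add: cl FT.meet_le)
    show "?r a b \<sqinter>\<^bsub>Fib P T\<^esub> ?r b c \<sqsubseteq>\<^bsub>Fib P T\<^esub> ?r a c" using that T A \<rho> by (simp add: equiv_rel_trans)
  qed (use that m in \<open>simp_all add: cl\<close>)
  have "m \<sqsubseteq>\<^bsub>Fib P T\<^esub> ?r x' x"
    by (rule FT.le_trans[OF m_le(2) equiv_rel_sym[OF \<rho> A T u(1) v(1)]]) (use m u v in \<open>simp_all add: cl\<close>)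
  then have "m \<sqsubseteq>\<^bsub>Fib P T\<^esub> ?r x' y'"
    using m_le u v by (blast intro: trans)
  then show "Reind P T (Prod P A A) u \<rho>
      \<sqinter>\<^bsub>Fib P T\<^esub> rel_at P T (Prod P A A) (prod_rel P A A \<rho> \<rho>) u v
      \<sqsubseteq>\<^bsub>Fib P T\<^esub> Reind P T (Prod P A A) v \<rho>"
    using T A \<rho> u v by (simp add: rel_at_prod_rel m_def)
qed (use \<rho> in simp)

text \<open>
  For descent data, substitution of equals comes for free: writing \<open>\<rho>\<close> for the relation on \<open>Y\<close>, the
  hypothesis on \<open>\<epsilon>\<close> says that \<open>\<epsilon>(y)\<close> implies \<open>\<rho>(d(p(y)), y)\<close>, and then \<open>\<beta>(d(p(y)))\<close> implies \<open>\<beta>(y)\<close>.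
\<close>

lemma galois_connection_Des:
  assumes obj: "X \<in> Obj P" "Y \<in> Obj P" and eq: "is_equiv_rel P X \<tau>" "is_equiv_rel P Y \<rho>"
    and p: "p \<in> quot_arrows P (Y, \<rho>) (X, \<tau>)" and d: "d \<in> quot_arrows P (X, \<tau>) (Y, \<rho>)"
    and retract: "Comp P X Y X p d = Ident P X"
    and \<epsilon>: "\<epsilon> \<in> carrier (Des P Y \<rho>)" "Reind P X Y d \<epsilon> = \<top>\<^bsub>Fib P X\<^esub>"
    and \<epsilon>_le: "\<epsilon> \<sqsubseteq>\<^bsub>Fib P Y\<^esub> rel_at P Y Y \<rho> (Comp P Y X Y d p) (Ident P Y)"
  shows "galois_connection \<lparr>orderA = Des P X \<tau>, orderB = Des P Y \<rho>,
    lower = (\<lambda>\<alpha>. Reind P Y X p \<alpha> \<sqinter>\<^bsub>Des P Y \<rho>\<^esub> \<epsilon>), upper = Reind P X Y d\<rparr>"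
proof -
  interpret E: prod_indexed_inf_semilattice "equiv_doctrine P"
    by (rule prod_indexed_inf_semilattice_equiv_doctrine)
  interpret FY: inf_semilattice "Fib P Y" by (rule Fib_inf_semilattice[OF obj(2)])
  note H = quot_arrows_in_Hom[OF p] quot_arrows_in_Hom[OF d]
  have transport: "Reind P Y X p (Reind P X Y d \<beta>) \<sqinter>\<^bsub>Des P Y \<rho>\<^esub> \<epsilon> \<sqsubseteq>\<^bsub>Fib P Y\<^esub> \<beta>"
    if \<beta>: "\<beta> \<in> carrier (Des P Y \<rho>)" for \<beta>
  proof -
    let ?dp = "Comp P Y X Y d p"
    have cl: "\<beta> \<in> carrier (Fib P Y)" "\<epsilon> \<in> carrier (Fib P Y)"
      using \<beta> \<epsilon> by (auto dest: Des_closed)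
    have "Reind P Y X p (Reind P X Y d \<beta>) \<in> carrier (Des P Y \<rho>)"
      by (rule Reind_Des[OF p Reind_Des[OF d \<beta> obj eq] obj(2,1) eq(2,1)])
    then have meet: "Reind P Y X p (Reind P X Y d \<beta>) \<sqinter>\<^bsub>Des P Y \<rho>\<^esub> \<epsilon>
        = Reind P Y Y ?dp \<beta> \<sqinter>\<^bsub>Fib P Y\<^esub> \<epsilon>"
      using meet_Des[OF obj(2) eq(2) _ \<epsilon>(1)] obj H cl by simp
    have "Reind P Y Y ?dp \<beta> \<sqinter>\<^bsub>Fib P Y\<^esub> \<epsilon>
        \<sqsubseteq>\<^bsub>Fib P Y\<^esub> Reind P Y Y ?dp \<beta> \<sqinter>\<^bsub>Fib P Y\<^esub> rel_at P Y Y \<rho> ?dp (Ident P Y)"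
      using \<epsilon>_le obj eq H cl by (intro FY.meet_mono) simp_all
    also have "\<dots> \<sqsubseteq>\<^bsub>Fib P Y\<^esub> Reind P Y Y (Ident P Y) \<beta>"
      using \<beta> obj eq H by (intro Des_descent) simp_all
    also have "\<dots> = \<beta>" using obj cl by simp
    finally show ?thesis unfolding meet using obj eq H cl by simp
  qed
  show ?thesis
    using E.galois_connection_reind_meet[of "(X, \<tau>)" "(Y, \<rho>)" p d \<epsilon>] assms transport
    by (simp add: top_Des del: Reind_Comp[symmetric])
qed

text \<open>
  Replacing the last coordinate by the one before it moves \<open>(x, y)\<close> to \<open>(x, x)\<close> and, with a parameter,
  \<open>(z, x, y)\<close> to \<open>(z, x, x)\<close>.  By reflexivity in the other coordinates, such a tuple is related to the
  original one in the product relation exactly to the extent \<open>\<rho>(x, y)\<close>.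
\<close>

lemma is_fibred_equality_equiv_doctrine:
  assumes A: "A \<in> Obj P" and \<rho>: "is_equiv_rel P A \<rho>"
  shows "is_fibred_equality (equiv_doctrine P) (A, \<rho>) \<rho>"
proof -
  interpret E: prod_indexed_inf_semilattice "equiv_doctrine P"
    by (rule prod_indexed_inf_semilattice_equiv_doctrine)
  have diag: "diag P A \<in> quot_arrows P (A, \<rho>) (Prod P A A, prod_rel P A A \<rho> \<rho>)"
    using E.diag_in_Hom[of "(A, \<rho>)"] A \<rho> by (simp add: diag_equiv_doctrine)
  have binary: "galois_connection
     \<lparr>orderA = Des P A \<rho>, orderB = Des P (Prod P A A) (prod_rel P A A \<rho> \<rho>),
      lower = (\<lambda>\<alpha>. Reind P (Prod P A A) A (Fst P A A) \<alpha>
        \<sqinter>\<^bsub>Des P (Prod P A A) (prod_rel P A A \<rho> \<rho>)\<^esub> \<rho>),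
      upper = Reind P A (Prod P A A) (diag P A)\<rparr>"
  proof (rule galois_connection_Des)
    interpret F: inf_semilattice "Fib P (Prod P A A)"
      using A by (intro Fib_inf_semilattice) simp
    show "\<rho> \<sqsubseteq>\<^bsub>Fib P (Prod P A A)\<^esub> rel_at P (Prod P A A) (Prod P A A) (prod_rel P A A \<rho> \<rho>)
        (Comp P (Prod P A A) A (Prod P A A) (diag P A) (Fst P A A)) (Ident P (Prod P A A))"
      using A \<rho> by (simp add: rel_at_prod_rel F.top_meet_eq)
  qed (use A \<rho> diag in \<open>simp_all add: Fst_in_quot_arrows equiv_rel_in_Des\<close>, simp_all add: diag_def)
  have with_parameter: "galois_connection
       \<lparr>orderA = Des P (Prod P X A) (prod_rel P X A \<tau> \<rho>),
        orderB = Des P (Prod3 P X A A) (prod_rel P (Prod P X A) A (prod_rel P X A \<tau> \<rho>) \<rho>),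
        lower = (\<lambda>\<alpha>. Reind P (Prod3 P X A A) (Prod P X A) (proj12 P X A A) \<alpha>
          \<sqinter>\<^bsub>Des P (Prod3 P X A A) (prod_rel P (Prod P X A) A (prod_rel P X A \<tau> \<rho>) \<rho>)\<^esub>
          Reind P (Prod3 P X A A) (Prod P A A) (proj23 P X A A) \<rho>),
        upper = Reind P (Prod P X A) (Prod3 P X A A) (pdiag P X A)\<rparr>"
    if X: "X \<in> Obj P" and \<tau>: "is_equiv_rel P X \<tau>" for X \<tau>
  proof (rule galois_connection_Des)
    let ?Y = "Prod3 P X A A" and ?R = "prod_rel P (Prod P X A) A (prod_rel P X A \<tau> \<rho>) \<rho>"
    interpret F: inf_semilattice "Fib P ?Y"
      using A X by (intro Fib_inf_semilattice) simp
    show p: "proj12 P X A A \<in> quot_arrows P (?Y, ?R) (Prod P X A, prod_rel P X A \<tau> \<rho>)"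
      using E.proj_in_Hom(4)[of "(X, \<tau>)" "(A, \<rho>)" "(A, \<rho>)"] A X \<rho> \<tau>
      by (simp add: proj12_equiv_doctrine)
    show "pdiag P X A \<in> quot_arrows P (Prod P X A, prod_rel P X A \<tau> \<rho>) (?Y, ?R)"
      using E.pdiag_in_Hom[of "(X, \<tau>)" "(A, \<rho>)"] A X \<rho> \<tau> by (simp add: pdiag_equiv_doctrine)
    have p23: "proj23 P X A A \<in> quot_arrows P (?Y, ?R) (Prod P A A, prod_rel P A A \<rho> \<rho>)"
      using E.proj_in_Hom(5)[of "(X, \<tau>)" "(A, \<rho>)" "(A, \<rho>)"] A X \<rho> \<tau>
      by (simp add: proj23_equiv_doctrine)
    show "Reind P ?Y (Prod P A A) (proj23 P X A A) \<rho> \<in> carrier (Des P ?Y ?R)"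
      using A X \<rho> \<tau> by (intro Reind_Des[OF p23 equiv_rel_in_Des]) simp_all
    \<comment> \<open>The pairing of the projections inside \<open>pdiag\<close> must not collapse to the identity before the
      equations for projections from a triple have been applied.\<close>
    show "Comp P (Prod P X A) ?Y (Prod P X A) (proj12 P X A A) (pdiag P X A) = Ident P (Prod P X A)"
      and "Reind P (Prod P X A) ?Y (pdiag P X A) (Reind P ?Y (Prod P A A) (proj23 P X A A) \<rho>)
        = \<top>\<^bsub>Fib P (Prod P X A)\<^esub>"
      using A X \<rho> \<tau> by (simp_all add: pdiag_def del: pairing_Fst_Snd) simp
    show "Reind P ?Y (Prod P A A) (proj23 P X A A) \<rho> \<sqsubseteq>\<^bsub>Fib P ?Y\<^esub>
        rel_at P ?Y ?Y ?R (Comp P ?Y (Prod P X A) ?Y (pdiag P X A) (proj12 P X A A)) (Ident P ?Y)"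
      using A X \<rho> \<tau>
      by (simp add: rel_at_prod_rel F.top_meet_eq proj12_def proj23_def proj1_def proj2_def proj3_def
          pdiag_def)
  qed (use A X \<rho> \<tau> in simp_all)
  show ?thesis
    unfolding is_fibred_equality_def
    using A \<rho> binary with_parameter
    by (auto simp: equiv_rel_in_Des diag_equiv_doctrine proj12_equiv_doctrine proj23_equiv_doctrine
        pdiag_equiv_doctrine)
qed

lemma fib_eq_equiv_doctrine:
  "\<lbrakk>A \<in> Obj P; is_equiv_rel P A \<rho>\<rbrakk> \<Longrightarrow> fib_eq (equiv_doctrine P) (A, \<rho>) = \<rho>"
  using prod_indexed_inf_semilattice.fib_eq_eqI[OF prod_indexed_inf_semilattice_equiv_doctrine]
  by (simp add: is_fibred_equality_equiv_doctrine)

lemma ext_arrows_equiv_doctrine: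
  assumes "X \<in> Obj (equiv_doctrine P)" "Y \<in> Obj (equiv_doctrine P)"
  shows "ext_arrows (equiv_doctrine P) X Y = quot_arrows P X Y"
  using assms by (cases X, cases Y)
    (auto simp: ext_arrows_def fib_eq_equiv_doctrine prod_arr_equiv_doctrine, auto simp: quot_arrows_def)

lemma ext_rel_equiv_doctrine:
  assumes "X \<in> Obj (equiv_doctrine P)" "Y \<in> Obj (equiv_doctrine P)"
  shows "ext_rel (equiv_doctrine P) X Y = quot_rel P X Y"
  using assms by (cases X, cases Y)
    (auto simp: ext_rel_def quot_rel_def ext_arrows_equiv_doctrine fib_eq_equiv_doctrine
      prod_arr_equiv_doctrine)

end

theorem corollary5p10:
  fixes P :: "('o, 'a, 'p) prod_indexed_poset"
  assumes "elementary_doctrine P"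
  shows "coincide (quot_completion P) (ext_collapse (equiv_doctrine P))"
proof -
  interpret elementary_doctrine P by fact
  have obj: "Obj (quot_completion P) = Obj (equiv_doctrine P)"
    "Obj (ext_collapse (equiv_doctrine P)) = Obj (equiv_doctrine P)"
    by (simp_all add: quot_completion_def equiv_doctrine_def ext_collapse_def)
  have "Ident (equiv_doctrine P) X = Ident P (fst X)"
    "Comp (equiv_doctrine P) X Y Z = Comp P (fst X) (fst Y) (fst Z)"
    "Fib (equiv_doctrine P) X = Des P (fst X) (snd X)"
    "Reind (equiv_doctrine P) X Y = Reind P (fst X) (fst Y)" for X Y Z
    by (simp_all add: equiv_doctrine_def split_beta)
  then show ?thesis
    unfolding coincide_def obj
    by (simp add: quot_completion_def ext_collapse_def split_beta ext_arrows_equiv_doctrine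
        ext_rel_equiv_doctrine)
qed

end
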